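(* For any number $n$ of players with hungry valuations, there is an RW moving knife protocol that computes a connected equitable allocation.
   Context: Cake cutting model. The cake is $[0,1]$, the players are $N=\{1,\dots,n\}$. Player $i$ has a private non-negative integrable value density $v_i$ on $[0,1]$ with $\int_0^1 v_i=1$, and $V_i(S)=\int_S v_i$. A player is hungry if $v_i(x)>0$ for all $x\in[0,1]$. A piece is a finite union of disjoint intervals, connected if it is a single interval; an allocation $A=(A_1,\dots,A_n)$ is a partition of $[0,1]$ into pieces, player $i$ receiving $A_i$. It is connected if each $A_i$ is, equitable if there is $c\in[0,1]$ with $V_i(A_i)=c$ for all $i$, and $\epsilon$-equitable if $|V_i(A_i)-V_j(A_j)|\le\epsilon$ for all $i,j$. RW (Robertson–Webb) queries. $\mathrm{Cut}_i(\alpha)$, $\alpha\in[0,1]$: player $i$ returns a point $y$ with $V_i([0,y])=\alpha$ (ties resolved deterministically), and $y$ becomes a cut point. $\mathrm{Eval}_i(y)$ for a previously made cut point $y$: player $i$ returns $V_i([0,y])$. RW moving knife step. There is a constant number $K$ of devices, numbered $1,\dots,K$; some are knives (with a position on the cake) and the others are triggers (with arbitrary real values). Each device $j$ is controlled by a player $i_j$ and has a real value $x_j(t)$ changing continuously as time $t$ proceeds from $\alpha$ to $\omega$, $0\le\alpha\le\omega\le1$; $x_j(t)\in[0,1]$ for knives, $x_j(t)\in\mathbb{R}$ for triggers. The first device is a knife with position equal to time. The value of each further device, $x_j(t)=F_j(t,x_1(t),\dots,x_{j-1}(t))$, may be obtained using at most $\ell$ RW queries to its owner (with current knife positions allowed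 as Eval inputs). It may depend arbitrarily on information about the players (cut points and values) obtained before the step, but its dependence on $t$ and $x_1(t),\dots,x_{j-1}(t)$ is Lipschitz continuous for all hungry valuations. Values of devices, once determined, are known to all. An outcome of the step is the index of a trigger $j$ with $x_j(\alpha)x_j(\omega)\le0$, a time $t$ with $x_j(t)=0$, and the values of all devices at $t$ (any such $t$ may be given). $\epsilon$-outcome. For a moving knife step: the index of a trigger $i$ with $x_i(\alpha)x_i(\omega)\le0$, a time $t$, and approximate values $\tilde x_1(t),\dots,\tilde x_K(t)$ such that $x_i(t)\in[-\epsilon,\epsilon]$ and $|\tilde x_j(t)-x_j(t)|\le\epsilon$ for all $j$. For an RW query: an answer within $\epsilon$ of the correct answer. RW moving knife protocol. It consists of a finite number of steps, each a moving knife step or an RW query; at the end it outputs an allocation depending on the outcomes of its steps. Robustness is also required: if the protocol outputs $\mathcal{F}$-fair allocations (for a fairness notion $\mathcal{F}$, here equitability) and completes in at most $r$ steps with a partition demarcated by $C$ cuts, then for all $\epsilon>0$, by iteratively replacing each outcome of a step by an $\epsilon$-outcome (the protocol choosing its next step based on this approximate information), it completes in at most $r$ steps with an $\epsilon$-$\mathcal{F}$-fair partition using at most $C$ cuts.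
   Formalization: Devices must be Lipschitz only when their owner's hungry density is bounded above and below by positive constants; for other hungry valuations only continuity in time is required, since Eval and Cut answers are not Lipschitz for unbounded or vanishing densities. *)

theory Defs
  imports "HOL-Analysis.Analysis"
begin

section \<open>Cakes, valuations, allocations\<close>

text \<open>The players are \<open>1, \<dots>, n\<close>; a profile \<open>V\<close> gives the value density \<open>V i\<close> of player \<open>i\<close>.
  For non-negative functions Henstock--Kurzweil and Lebesgue integrability coincide.\<close>

type_synonym profile = "nat \<Rightarrow> real \<Rightarrow> real"
type_synonym allocation = "nat \<Rightarrow> real set"

definition value_density :: "(real \<Rightarrow> real) \<Rightarrow> bool" where
  "value_density v \<longleftrightarrow>
     (\<forall>x\<in>{0..1}. 0 \<le> v x) \<and> v integrable_on {0..1} \<and> integral {0..1} v = 1"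

definition hungry :: "(real \<Rightarrow> real) \<Rightarrow> bool" where
  "hungry v \<longleftrightarrow> value_density v \<and> (\<forall>x\<in>{0..1}. 0 < v x)"

definition hungry_profile :: "nat \<Rightarrow> profile \<Rightarrow> bool" where
  "hungry_profile n V \<longleftrightarrow> (\<forall>i\<in>{1..n}. hungry (V i))"

definition bounded_density :: "(real \<Rightarrow> real) \<Rightarrow> bool" where
  "bounded_density v \<longleftrightarrow> (\<exists>a>0. \<exists>b. \<forall>x\<in>{0..1}. a \<le> v x \<and> v x \<le> b)"

definition worth :: "(real \<Rightarrow> real) \<Rightarrow> real set \<Rightarrow> real" where
  "worth v S = integral S v"

definition piece :: "real set \<Rightarrow> bool" where
  "piece S \<longleftrightarrow>
     (\<exists>\<I>. finite \<I> \<and> disjoint \<I> \<and> (\<forall>I\<in>\<I>. is_interval I) \<and> S = \<Union>\<I>)"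

definition is_allocation :: "nat \<Rightarrow> allocation \<Rightarrow> bool" where
  "is_allocation n A \<longleftrightarrow>
     (\<forall>i\<in>{1..n}. piece (A i)) \<and> disjoint_family_on A {1..n} \<and> (\<Union>i\<in>{1..n}. A i) = {0..1}"

definition connected_allocation :: "nat \<Rightarrow> allocation \<Rightarrow> bool" where
  "connected_allocation n A \<longleftrightarrow> is_allocation n A \<and> (\<forall>i\<in>{1..n}. is_interval (A i))"

definition equitable :: "nat \<Rightarrow> profile \<Rightarrow> allocation \<Rightarrow> bool" where
  "equitable n V A \<longleftrightarrow> (\<exists>c\<in>{0..1}. \<forall>i\<in>{1..n}. worth (V i) (A i) = c)"

definition eps_equitable :: "nat \<Rightarrow> real \<Rightarrow> profile \<Rightarrow> allocation \<Rightarrow> bool" where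
  "eps_equitable n \<epsilon> V A \<longleftrightarrow>
     (\<forall>i\<in>{1..n}. \<forall>j\<in>{1..n}. \<bar>worth (V i) (A i) - worth (V j) (A j)\<bar> \<le> \<epsilon>)"

text \<open>The cuts demarcating an allocation are the interior boundary points of its pieces.\<close>

definition demarcated_by :: "nat \<Rightarrow> nat \<Rightarrow> allocation \<Rightarrow> bool" where
  "demarcated_by n C A \<longleftrightarrow>
     (let D = (\<Union>i\<in>{1..n}. frontier (A i)) \<inter> {0<..<1} in finite D \<and> card D \<le> C)"


section \<open>Robertson--Webb queries\<close>

datatype rw_query = Cut real | Eval real

text \<open>Ties are resolved in favour of the leftmost point; for a hungry player the answer to a
  cut query is unique.\<close>

definition cut_point :: "(real \<Rightarrow> real) \<Rightarrow> real \<Rightarrow> real" where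
  "cut_point v \<alpha> = Inf {y \<in> {0..1}. worth v {0..y} = \<alpha>}"

fun rw_answer :: "(real \<Rightarrow> real) \<Rightarrow> rw_query \<Rightarrow> real" where
  "rw_answer v (Cut \<alpha>) = cut_point v \<alpha>"
| "rw_answer v (Eval y) = worth v {0..y}"

text \<open>\<open>P\<close> is the set of cut points made so far. The explicit \<open>y \<in> {0..1}\<close> matters because an
  approximate answer to a cut query may lie slightly outside the cake.\<close>

fun legal_query :: "real set \<Rightarrow> rw_query \<Rightarrow> bool" where
  "legal_query P (Cut \<alpha>) \<longleftrightarrow> \<alpha> \<in> {0..1}"
| "legal_query P (Eval y) \<longleftrightarrow> y \<in> P \<and> y \<in> {0..1}"

fun new_cuts :: "rw_query \<Rightarrow> real \<Rightarrow> real set" where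
  "new_cuts (Cut \<alpha>) a = {a}"
| "new_cuts (Eval y) a = {}"


section \<open>Moving knife steps\<close>

text \<open>An adaptive computation that queries a single player and finally returns a real number.
  It has no access to the player's density except through the answers.\<close>

datatype rw_program = Return real | Ask rw_query "real \<Rightarrow> rw_program"

primrec result :: "(real \<Rightarrow> real) \<Rightarrow> rw_program \<Rightarrow> real" where
  "result v (Return x) = x"
| "result v (Ask q k) = result v (k (rw_answer v q))"

text \<open>At most \<open>l\<close> queries, all of them legal given the cut points \<open>P\<close>.\<close>

primrec legal_program :: "(real \<Rightarrow> real) \<Rightarrow> rw_program \<Rightarrow> nat \<Rightarrow> real set \<Rightarrow> bool" where
  "legal_program v (Return x) = (\<lambda>l P. True)"
| "legal_program v (Ask q k) =
     (\<lambda>l P. 0 < l \<and> legal_query P q \<and>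
        legal_program v (k (rw_answer v q)) (l - 1) (P \<union> new_cuts q (rw_answer v q)))"

text \<open>The program of the \<open>j\<close>-th device takes the time \<open>t\<close> and the list of the values of the
  preceding devices. Devices are numbered from \<open>0\<close>, following list indices.\<close>

record device =
  knife :: bool
  owner :: nat
  program :: "real \<Rightarrow> real list \<Rightarrow> rw_program"

record knife_step =
  start :: real
  stop :: real
  devices :: "device list"

definition device_fun :: "profile \<Rightarrow> device \<Rightarrow> real \<Rightarrow> real list \<Rightarrow> real" where
  "device_fun V d t xs = result (V (owner d)) (program d t xs)"

definition device_values :: "profile \<Rightarrow> knife_step \<Rightarrow> real \<Rightarrow> real list" where
  "device_values V s t = foldl (\<lambda>xs d. xs @ [device_fun V d t xs]) [] (devices s)"

definition knife_positions :: "knife_step \<Rightarrow> real list \<Rightarrow> real set" where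
  "knife_positions s xs = {xs ! i | i. i < length xs \<and> knife (devices s ! i)}"

text \<open>The arguments on which the \<open>j\<close>-th device function is considered: all times in the time
  interval and all values of the preceding devices, positions of knives being in the cake.\<close>

definition device_domain :: "knife_step \<Rightarrow> nat \<Rightarrow> (real \<times> real list) set" where
  "device_domain s j =
     {(t, xs). t \<in> {start s..stop s} \<and> length xs = j \<and> knife_positions s xs \<subseteq> {0..1}}"

definition lipschitz_device :: "profile \<Rightarrow> knife_step \<Rightarrow> nat \<Rightarrow> bool" where
  "lipschitz_device V s j \<longleftrightarrow>
     (\<exists>L. \<forall>(t, xs) \<in> device_domain s j. \<forall>(u, ys) \<in> device_domain s j.
        \<bar>device_fun V (devices s ! j) t xs - device_fun V (devices s ! j) u ys\<bar>
          \<le> L * (\<bar>t - u\<bar> + (\<Sum>i<j. \<bar>xs ! i - ys ! i\<bar>)))"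

text \<open>Continuity in time is required for every hungry profile. Query answers can depend
  Lipschitz continuously on their arguments only if the density of the queried player is bounded
  from above (for evaluations) and from below by a positive constant (for cuts), so Lipschitz
  continuity is demanded for all hungry owners whose density has such bounds.\<close>

definition legal_device :: "profile \<Rightarrow> nat \<Rightarrow> real set \<Rightarrow> knife_step \<Rightarrow> nat \<Rightarrow> bool" where
  "legal_device V l P s j \<longleftrightarrow>
     (let d = devices s ! j in
       (\<forall>(t, xs) \<in> device_domain s j.
          legal_program (V (owner d)) (program d t xs) l (P \<union> knife_positions s xs) \<and>
          (knife d \<longrightarrow> device_fun V d t xs \<in> {0..1})) \<and>
       continuous_on {start s..stop s} (\<lambda>t. device_values V s t ! j) \<and>
       (bounded_density (V (owner d)) \<longrightarrow> lipschitz_device V s j))"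

definition active_trigger :: "profile \<Rightarrow> knife_step \<Rightarrow> nat \<Rightarrow> bool" where
  "active_trigger V s j \<longleftrightarrow>
     j < length (devices s) \<and> \<not> knife (devices s ! j) \<and>
     device_values V s (start s) ! j * device_values V s (stop s) ! j \<le> 0"

text \<open>The last conjunct makes sure that the step has an outcome, i.e. that a protocol executing
  it does not get stuck.\<close>

definition legal_step ::
  "nat \<Rightarrow> profile \<Rightarrow> nat \<Rightarrow> nat \<Rightarrow> real set \<Rightarrow> knife_step \<Rightarrow> bool" where
  "legal_step n V K l P s \<longleftrightarrow>
     0 \<le> start s \<and> start s \<le> stop s \<and> stop s \<le> 1 \<and>
     1 \<le> length (devices s) \<and> length (devices s) \<le> K \<and>
     (\<forall>d\<in>set (devices s). owner d \<in> {1..n}) \<and>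
     knife (devices s ! 0) \<and>
     (\<forall>t\<in>{start s..stop s}. device_fun V (devices s ! 0) t [] = t) \<and>
     (\<forall>j<length (devices s). legal_device V l P s j) \<and>
     (\<exists>j. active_trigger V s j)"

text \<open>An outcome consists of the index of a trigger, a time, and the values of all devices.
  The outcomes proper are the \<open>0\<close>-outcomes.\<close>

type_synonym outcome = "nat \<times> real \<times> real list"

fun eps_outcome :: "profile \<Rightarrow> real \<Rightarrow> knife_step \<Rightarrow> outcome \<Rightarrow> bool" where
  "eps_outcome V \<epsilon> s (j, t, xs) \<longleftrightarrow>
     active_trigger V s j \<and> t \<in> {start s..stop s} \<and>
     \<bar>device_values V s t ! j\<bar> \<le> \<epsilon> \<and>
     length xs = length (devices s) \<and>
     (\<forall>i<length xs. \<bar>xs ! i - device_values V s t ! i\<bar> \<le> \<epsilon>)"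


section \<open>Moving knife protocols\<close>

text \<open>The continuations receive the outcome of the step just executed, so that each step and
  the final allocation may depend on all information obtained before, but on nothing else about
  the players.\<close>

datatype protocol =
    Output allocation
  | Query nat rw_query "real \<Rightarrow> protocol"
  | Move knife_step "outcome \<Rightarrow> protocol"

text \<open>\<open>reaches V \<epsilon> p m P p'\<close>: if each outcome is replaced by an \<open>\<epsilon>\<close>-outcome, then \<open>p\<close> may have
  become \<open>p'\<close> after \<open>m\<close> steps, with \<open>P\<close> the cut points made so far. For \<open>\<epsilon> = 0\<close> this is exact
  execution. The positions of the knives at the end of a moving knife step become cut points;
  the first knife is at position \<open>t\<close>.\<close>

inductive reaches ::
  "profile \<Rightarrow> real \<Rightarrow> protocol \<Rightarrow> nat \<Rightarrow> real set \<Rightarrow> protocol \<Rightarrow> bool"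
  for V :: profile and \<epsilon> :: real and p :: protocol where
  init: "reaches V \<epsilon> p 0 {} p"
| query: "reaches V \<epsilon> p m P (Query i q k) \<Longrightarrow> \<bar>a - rw_answer (V i) q\<bar> \<le> \<epsilon> \<Longrightarrow>
     reaches V \<epsilon> p (Suc m) (P \<union> new_cuts q a) (k a)"
| move: "reaches V \<epsilon> p m P (Move s k) \<Longrightarrow> eps_outcome V \<epsilon> s (j, t, xs) \<Longrightarrow>
     reaches V \<epsilon> p (Suc m) (P \<union> {t} \<union> knife_positions s xs) (k (j, t, xs))"

text \<open>All executions from \<open>p\<close> take at most \<open>r\<close> steps, all of them legal. As protocols are
  well-founded trees and legal steps have outcomes, every execution can be completed.\<close>

definition legal_execution ::
  "nat \<Rightarrow> profile \<Rightarrow> nat \<Rightarrow> nat \<Rightarrow> real \<Rightarrow> nat \<Rightarrow> protocol \<Rightarrow> bool" where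
  "legal_execution n V K l \<epsilon> r p \<longleftrightarrow>
     (\<forall>m P p'. reaches V \<epsilon> p m P p' \<longrightarrow>
        m \<le> r \<and>
        (case p' of
           Output A \<Rightarrow> is_allocation n A
         | Query i q k \<Rightarrow> i \<in> {1..n} \<and> legal_query P q
         | Move s k \<Rightarrow> legal_step n V K l P s))"

definition outputs :: "profile \<Rightarrow> real \<Rightarrow> protocol \<Rightarrow> allocation \<Rightarrow> bool" where
  "outputs V \<epsilon> p A \<longleftrightarrow> (\<exists>m P. reaches V \<epsilon> p m P (Output A))"

text \<open>Robustness with respect to equitability, for executions with \<open>K\<close> devices per step and
  \<open>l\<close> queries per device.\<close>

definition robust_equitable :: "nat \<Rightarrow> nat \<Rightarrow> nat \<Rightarrow> protocol \<Rightarrow> bool" where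
  "robust_equitable n K l p \<longleftrightarrow>
     (\<forall>r C.
        (\<forall>V. hungry_profile n V \<longrightarrow>
           legal_execution n V K l 0 r p \<and>
           (\<forall>A. outputs V 0 p A \<longrightarrow> equitable n V A \<and> demarcated_by n C A)) \<longrightarrow>
        (\<forall>\<epsilon>>0. \<forall>V. hungry_profile n V \<longrightarrow>
           legal_execution n V K l \<epsilon> r p \<and>
           (\<forall>A. outputs V \<epsilon> p A \<longrightarrow> eps_equitable n \<epsilon> V A \<and> demarcated_by n C A)))"

definition RW_moving_knife_protocol :: "nat \<Rightarrow> protocol \<Rightarrow> bool" where
  "RW_moving_knife_protocol n p \<longleftrightarrow>
     (\<exists>K l r. (\<forall>V. hungry_profile n V \<longrightarrow> legal_execution n V K l 0 r p) \<and>
        robust_equitable n K l p)"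

definition computes_connected_equitable :: "nat \<Rightarrow> protocol \<Rightarrow> bool" where
  "computes_connected_equitable n p \<longleftrightarrow>
     (\<forall>V. hungry_profile n V \<longrightarrow>
        (\<forall>A. outputs V 0 p A \<longrightarrow> connected_allocation n A \<and> equitable n V A))"

end

theory Submission
  imports Defs
begin

text \<open>Approximate knife positions are useless, since a density may be arbitrarily large there; but
  the time \<open>t\<close> of an outcome is exact. So there is one moving knife step for each of the \<open>n - 1\<close>
  cuts, which keeps only the time as the position of the cut. Let \<open>c\<close> be the value of the first
  piece. In the step of player \<open>i\<close>, let \<open>f t\<close> be the excess over \<open>c\<close> of this player's piece if it
  ends at \<open>t\<close>, and let \<open>g t\<close> be the excess over \<open>c\<close> of what remains for player \<open>n\<close> once the players
  in between have cut off pieces of value \<open>c\<close> to the right of \<open>t\<close>. The trigger is \<open>f - g\<close>. As \<open>f\<close>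
  increases and \<open>g\<close> decreases, and both are nearly \<open>0\<close> at player \<open>i\<close>'s exact cut by the preceding
  step, both are nearly \<open>0\<close> at a near-zero of \<open>f - g\<close>. Each step adds at most the tolerance of its
  trigger to the error, and scaling the triggers by \<open>2n\<close> keeps the total within \<open>\<epsilon>\<close>.\<close>

section \<open>Valuations of hungry players\<close>

abbreviation cum :: "(real \<Rightarrow> real) \<Rightarrow> real \<Rightarrow> real" where
  "cum v y \<equiv> worth v {0..y}"

text \<open>Retraction onto the unit interval. It keeps a cut query legal when the requested value
  exceeds what is left; the answer is then the right end of the cake.\<close>

definition clip :: "real \<Rightarrow> real" where
  "clip x = max 0 (min 1 x)"

lemma clip_range [simp]: "clip x \<in> {0..1}" "0 \<le> clip x" "clip x \<le> 1"
  by (auto simp: clip_def)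

lemma clip_mono: "x \<le> y \<Longrightarrow> clip x \<le> clip y"
  by (auto simp: clip_def)

lemma clip_lipschitz: "\<bar>clip x - clip y\<bar> \<le> \<bar>x - y\<bar>"
  by (auto simp: clip_def max_def min_def)

lemma continuous_on_clip [continuous_intros]:
  "continuous_on S f \<Longrightarrow> continuous_on S (\<lambda>x. clip (f x))"
  unfolding clip_def by (intro continuous_intros)

lemma hungry_integrable:
  assumes "hungry v" "0 \<le> x" "y \<le> 1"
  shows "v integrable_on {x..y}"
  using assms integrable_subinterval_real[of v 0 1 x y]
  by (auto simp: hungry_def value_density_def)

lemma worth_singleton [simp]: "worth v {x} = 0"
  by (simp add: worth_def)

lemma cum_1 [simp]: "hungry v \<Longrightarrow> cum v 1 = 1"
  by (simp add: worth_def hungry_def value_density_def)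

lemma cum_diff:
  assumes "hungry v" "0 \<le> x" "x \<le> y" "y \<le> 1"
  shows "cum v y - cum v x = integral {x..y} v"
  using Henstock_Kurzweil_Integration.integral_combine[of 0 x y v] hungry_integrable[of v 0 y] assms
  by (simp add: worth_def)

lemma worth_greaterThanAtMost:
  assumes "hungry v" "0 \<le> x" "x \<le> y" "y \<le> 1"
  shows "worth v {x<..y} = cum v y - cum v x"
proof -
  have "worth v {x<..y} = integral {x..y} v"
    unfolding worth_def
    by (rule integral_spike_set; rule negligible_subset[of "{x}"]) auto
  then show ?thesis
    using cum_diff[OF assms] by simp
qed

lemma continuous_on_cum: "hungry v \<Longrightarrow> continuous_on {0..1} (cum v)"
  unfolding worth_def
  by (rule indefinite_integral_continuous_1) (simp add: hungry_integrable)

text \<open>A density that is positive everywhere may still come arbitrarily close to 0, so no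
  uniform lower bound is available. Instead, a vanishing integral of a non-negative function forces
  it to be 0 almost everywhere, which would make a nondegenerate interval a null set.\<close>

lemma cum_strict_mono:
  assumes v: "hungry v" and xy: "0 \<le> x" "x < y" "y \<le> 1"
  shows "cum v x < cum v y"
proof -
  have pos: "\<And>z. z \<in> {x..y} \<Longrightarrow> 0 < v z"
    using assms by (auto simp: hungry_def)
  have int: "v integrable_on {x..y}"
    using hungry_integrable v xy by simp
  have "integral {x..y} v \<ge> 0"
    using int pos by (intro integral_nonneg) (auto intro: less_imp_le)
  moreover have "integral {x..y} v \<noteq> 0"
  proof
    assume 0: "integral {x..y} v = 0"
    \<comment> \<open>For a non-negative function gauge integrability implies absolute
      integrability, so the integral can be read as a Lebesgue integral, where the almost-everywhere
      criterion applies.\<close>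
    have "v absolutely_integrable_on {x..y}"
      using int pos by (intro nonnegative_absolutely_integrable_1) (auto intro: less_imp_le)
    then have "integrable lebesgue (\<lambda>z. indicator {x..y} z * v z)"
      and "integral\<^sup>L lebesgue (\<lambda>z. indicator {x..y} z * v z) = 0"
      using 0 set_lebesgue_integral_eq_integral(2)[of "{x..y}" v]
      by (simp_all add: set_integrable_def set_lebesgue_integral_def)
    moreover have "AE z in lebesgue. 0 \<le> indicator {x..y} z * v z"
      using pos by (intro AE_I2) (auto simp: indicator_def intro: less_imp_le)
    ultimately have "AE z in lebesgue. indicator {x..y} z * v z = 0"
      using integral_nonneg_eq_0_iff_AE by blast
    then have "AE z in lebesgue. z \<notin> {x..y}"
      by eventually_elim (use pos in \<open>force simp: indicator_def\<close>)
    then have "{x..y} \<in> null_sets lebesgue"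
      using AE_iff_null_sets[of "{x..y}" lebesgue] by simp
    then show False
      using xy negligible_iff_null_sets negligible_interval(1)[of x y] by auto
  qed
  ultimately show ?thesis
    using cum_diff[of v x y] v xy by simp
qed

lemma cum_mono:
  assumes "hungry v" "0 \<le> x" "x \<le> y" "y \<le> 1"
  shows "cum v x \<le> cum v y"
  using cum_strict_mono[of v x y] assms by (cases "x = y") auto

lemma cum_range:
  assumes "hungry v" "y \<in> {0..1}"
  shows "cum v y \<in> {0..1}"
  using cum_mono[of v 0 y] cum_mono[of v y 1] assms by simp

lemma inj_on_cum: "hungry v \<Longrightarrow> inj_on (cum v) {0..1}"
  by (rule linorder_inj_onI) (use cum_strict_mono[of v] in force, auto)

text \<open>By injectivity the set whose infimum defines \<open>cut_point\<close> is a singleton, so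
  the resolution of ties never matters for a hungry player.\<close>

lemma cut_point_cum:
  assumes "hungry v" "y \<in> {0..1}"
  shows "cut_point v (cum v y) = y"
proof -
  have "{z \<in> {0..1}. cum v z = cum v y} = {y}"
    using inj_on_cum[OF assms(1)] assms(2) by (auto dest: inj_onD)
  then show ?thesis
    by (simp add: cut_point_def)
qed

lemma cum_image:
  assumes "hungry v"
  shows "cum v ` {0..1} = {0..1}"
proof
  show "cum v ` {0..1} \<subseteq> {0..1}"
    using cum_range[OF assms] by blast
  show "{0..1} \<subseteq> cum v ` {0..1}"
  proof
    fix a :: real assume "a \<in> {0..1}"
    then obtain x where "0 \<le> x" "x \<le> 1" "cum v x = a"
      using IVT'[of "cum v" 0 a 1] continuous_on_cum[OF assms] assms by auto
    then show "a \<in> cum v ` {0..1}"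
      by auto
  qed
qed

lemma
  assumes "hungry v" "a \<in> {0..1}"
  shows cut_point_range: "cut_point v a \<in> {0..1}"
    and cum_cut_point: "cum v (cut_point v a) = a"
proof -
  obtain y where "y \<in> {0..1}" "a = cum v y"
    using cum_image assms by blast
  then show "cut_point v a \<in> {0..1}" "cum v (cut_point v a) = a"
    using cut_point_cum assms(1) by auto
qed

lemma cut_point_0: "hungry v \<Longrightarrow> cut_point v 0 = 0"
  using cut_point_cum[of v 0] by simp

lemma cut_point_1: "hungry v \<Longrightarrow> cut_point v 1 = 1"
  using cut_point_cum[of v 1] by simp

lemma cut_point_mono:
  assumes "hungry v" "0 \<le> a" "a \<le> b" "b \<le> 1"
  shows "cut_point v a \<le> cut_point v b"
proof (rule ccontr)
  assume "\<not> ?thesis"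
  then have "cum v (cut_point v b) < cum v (cut_point v a)"
    using cut_point_range[of v a] cut_point_range[of v b] assms
    by (intro cum_strict_mono) auto
  then show False
    using assms by (simp add: cum_cut_point)
qed

text \<open>The inverse of a continuous injection on a compact set is continuous on the
  image.\<close>

lemma continuous_on_cut_point:
  assumes "hungry v"
  shows "continuous_on {0..1} (cut_point v)"
  using continuous_on_inv[OF continuous_on_cum[OF assms], of "cut_point v"]
    cut_point_cum[OF assms] cum_image[OF assms] by simp

lemma cum_growth:
  assumes "hungry v" "0 \<le> x" "x \<le> y" "y \<le> 1"
    and "\<And>z. z \<in> {0..1} \<Longrightarrow> a \<le> v z \<and> v z \<le> b"
  shows "a * (y - x) \<le> cum v y - cum v x" "cum v y - cum v x \<le> b * (y - x)"
proof -
  have int: "(v has_integral (cum v y - cum v x)) {x..y}"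
    using cum_diff[OF assms(1-4)] hungry_integrable[of v x y] assms by (simp add: integrable_integral)
  have "((\<lambda>z. a) has_integral a * (y - x)) {x..y}" "((\<lambda>z. b) has_integral b * (y - x)) {x..y}"
    using has_integral_const_real[of a x y] has_integral_const_real[of b x y] assms(3)
    by (simp_all add: mult.commute)
  then show "a * (y - x) \<le> cum v y - cum v x" "cum v y - cum v x \<le> b * (y - x)"
    using has_integral_le[OF _ int] has_integral_le[OF int] assms by auto
qed

text \<open>The upper bound \<open>b\<close> on the density is a Lipschitz constant for evaluations;
  the lower bound \<open>a\<close> gives \<open>1 / a\<close> for cuts. One constant
  \<open>B\<close> serves both.\<close>

lemma bounded_density_lipschitz:
  assumes "hungry v" "bounded_density v"
  obtains B where "B \<ge> 0"
    "\<And>x y. x \<in> {0..1} \<Longrightarrow> y \<in> {0..1} \<Longrightarrow> \<bar>cum v x - cum v y\<bar> \<le> B * \<bar>x - y\<bar>"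
    "\<And>x y. x \<in> {0..1} \<Longrightarrow> y \<in> {0..1} \<Longrightarrow> \<bar>cut_point v x - cut_point v y\<bar> \<le> B * \<bar>x - y\<bar>"
proof -
  obtain a b where ab: "a > 0" "\<And>z. z \<in> {0..1} \<Longrightarrow> a \<le> v z \<and> v z \<le> b"
    using assms(2) unfolding bounded_density_def by blast
  have b: "b > 0"
    using ab(1) ab(2)[of 0] by simp
  define B where "B = max b (1 / a)"
  have B: "B > 0" "b \<le> B" "1 / a \<le> B"
    using ab(1) b by (auto simp: B_def)
  have *: "a * \<bar>x - y\<bar> \<le> \<bar>cum v x - cum v y\<bar> \<and> \<bar>cum v x - cum v y\<bar> \<le> b * \<bar>x - y\<bar>"
    if "x \<in> {0..1}" "y \<in> {0..1}" for x y
  proof (cases "x \<le> y")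
    case True
    then have "a * (y - x) \<le> cum v y - cum v x" "cum v y - cum v x \<le> b * (y - x)"
      using cum_growth[of v x y a b] that assms(1) ab by auto
    then show ?thesis
      using True cum_mono[of v x y] that assms(1) by simp
  next
    case False
    then have "a * (x - y) \<le> cum v x - cum v y" "cum v x - cum v y \<le> b * (x - y)"
      using cum_growth[of v y x a b] that assms(1) ab by auto
    then show ?thesis
      using False cum_mono[of v y x] that assms(1) by simp
  qed
  show ?thesis
  proof (rule that[of B])
    fix x y :: real assume xy: "x \<in> {0..1}" "y \<in> {0..1}"
    show "\<bar>cum v x - cum v y\<bar> \<le> B * \<bar>x - y\<bar>"
      using *[OF xy] mult_right_mono[OF B(2), of "\<bar>x - y\<bar>"] by simp
    have "a * \<bar>cut_point v x - cut_point v y\<bar> \<le> \<bar>x - y\<bar>"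
      using *[of "cut_point v x" "cut_point v y"] xy assms(1)
      by (simp add: cut_point_range cum_cut_point del: atLeastAtMost_iff)
    then have "\<bar>cut_point v x - cut_point v y\<bar> \<le> 1 / a * \<bar>x - y\<bar>"
      using ab(1) by (simp add: field_simps)
    also have "\<dots> \<le> B * \<bar>x - y\<bar>"
      using mult_right_mono[OF B(3), of "\<bar>x - y\<bar>"] by simp
    finally show "\<bar>cut_point v x - cut_point v y\<bar> \<le> B * \<bar>x - y\<bar>" .
  qed (use B in simp)
qed


section \<open>Devices\<close>

text \<open>Auxiliary values in the unit interval are kept as knife positions rather than triggers, so that
  the last device is the only trigger and no other one can be reported as the outcome.\<close>

definition time_knife :: device where
  "time_knife = \<lparr>knife = True, owner = 1, program = (\<lambda>t xs. Return t)\<rparr>"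

text \<open>This device supplies the common value \<open>c\<close>. The first cut is
  \<open>hd ts\<close> once it has been made; in the very first step it is the moving knife
  itself.\<close>

definition first_value_knife :: "real list \<Rightarrow> device" where
  "first_value_knife ts =
     \<lparr>knife = True, owner = 1, program = (\<lambda>t xs. Ask (Eval (hd (ts @ [xs ! 0]))) Return)\<rparr>"

text \<open>Repeating the moving position after \<open>c\<close> makes \<open>last xs\<close> the
  correct starting point, so that chain and rest knives can read their predecessor uniformly even
  when the chain is empty.\<close>

definition copy_knife :: device where
  "copy_knife = \<lparr>knife = True, owner = 1, program = (\<lambda>t xs. Return (xs ! 0))\<rparr>"

text \<open>Here \<open>xs ! 1\<close> is the common value \<open>c\<close>, and
  \<open>last xs\<close> is the preceding cut in the chain.\<close>

definition chain_knife :: "nat \<Rightarrow> device" where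
  "chain_knife j = \<lparr>knife = True, owner = j, program = (\<lambda>t xs.
     Ask (Eval (last xs)) (\<lambda>a. Ask (Cut (clip (xs ! 1 + a))) Return))\<rparr>"

text \<open>The value is what player \<open>n\<close> sees to the left of the last chain cut. Player
  \<open>n\<close> is left with its complement to \<open>1\<close>, which explains the
  \<open>- 1\<close> in the trigger.\<close>

definition rest_knife :: "nat \<Rightarrow> device" where
  "rest_knife n = \<lparr>knife = True, owner = n, program = (\<lambda>t xs. Ask (Eval (last xs)) Return)\<rparr>"

text \<open>In the difference of the two excesses the common value \<open>c\<close> cancels. Before the first cut,
  \<open>Cut 0\<close> stands in for \<open>Eval 0\<close>, which would be illegal: both answers are \<open>0\<close>.\<close>

definition final_trigger :: "nat \<Rightarrow> real list \<Rightarrow> device" where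
  "final_trigger n ts = \<lparr>knife = False, owner = Suc (length ts), program = (\<lambda>t xs.
     Ask (Eval (xs ! 0)) (\<lambda>a. Ask (if ts = [] then Cut 0 else Eval (last ts)) (\<lambda>b.
       Return (2 * real n * (a - b - 1 + last xs)))))\<rparr>"

lemmas device_defs = time_knife_def first_value_knife_def copy_knife_def chain_knife_def
  rest_knife_def final_trigger_def

text \<open>Legality of one device in isolation, for arbitrary preceding values in the unit
  interval. As all preceding devices will be knives, \<open>set xs\<close> plays the role of their
  positions. Continuity is asked along every continuous curve \<open>X\<close> of preceding values,
  so that it can be propagated from device to device.\<close>

definition admissible :: "profile \<Rightarrow> real set \<Rightarrow> real set \<Rightarrow> nat \<Rightarrow> device \<Rightarrow> bool" where
  "admissible V P T j d \<longleftrightarrow>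
     (\<forall>t\<in>T. \<forall>xs. length xs = j \<and> set xs \<subseteq> {0..1} \<longrightarrow>
        legal_program (V (owner d)) (program d t xs) 2 (P \<union> set xs) \<and>
        (knife d \<longrightarrow> device_fun V d t xs \<in> {0..1})) \<and>
     (\<forall>X. (\<forall>t\<in>T. length (X t) = j \<and> set (X t) \<subseteq> {0..1}) \<and>
          (\<forall>i<j. continuous_on T (\<lambda>t. X t ! i)) \<longrightarrow>
        continuous_on T (\<lambda>t. device_fun V d t (X t))) \<and>
     (bounded_density (V (owner d)) \<longrightarrow>
        (\<exists>L. \<forall>t\<in>T. \<forall>u\<in>T. \<forall>xs ys.
           length xs = j \<and> set xs \<subseteq> {0..1} \<and> length ys = j \<and> set ys \<subseteq> {0..1} \<longrightarrow>
           \<bar>device_fun V d t xs - device_fun V d u ys\<bar>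
             \<le> L * (\<bar>t - u\<bar> + (\<Sum>i<j. \<bar>xs ! i - ys ! i\<bar>))))"

text \<open>The Lipschitz condition is reduced to a single bound \<open>D\<close> on the time
  difference and all coordinate differences, which is easier to check for each device.\<close>

lemma admissibleI:
  assumes "\<And>t xs. t \<in> T \<Longrightarrow> length xs = j \<Longrightarrow> set xs \<subseteq> {0..1} \<Longrightarrow>
      legal_program (V (owner d)) (program d t xs) 2 (P \<union> set xs)"
    and "\<And>t xs. t \<in> T \<Longrightarrow> length xs = j \<Longrightarrow> set xs \<subseteq> {0..1} \<Longrightarrow> knife d \<Longrightarrow>
      device_fun V d t xs \<in> {0..1}"
    and "\<And>X. (\<And>t. t \<in> T \<Longrightarrow> length (X t) = j) \<Longrightarrow>
      (\<And>t i. t \<in> T \<Longrightarrow> i < j \<Longrightarrow> X t ! i \<in> {0..1}) \<Longrightarrow>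
      (\<And>i. i < j \<Longrightarrow> continuous_on T (\<lambda>t. X t ! i)) \<Longrightarrow>
      continuous_on T (\<lambda>t. device_fun V d t (X t))"
    and "bounded_density (V (owner d)) \<Longrightarrow>
      \<exists>L. \<forall>t u xs ys D. t \<in> T \<longrightarrow> u \<in> T \<longrightarrow> length xs = j \<longrightarrow> length ys = j \<longrightarrow>
        (\<forall>i<j. xs ! i \<in> {0..1} \<and> ys ! i \<in> {0..1} \<and> \<bar>xs ! i - ys ! i\<bar> \<le> D) \<longrightarrow>
        \<bar>t - u\<bar> \<le> D \<longrightarrow>
        \<bar>device_fun V d t xs - device_fun V d u ys\<bar> \<le> L * D"
  shows "admissible V P T j d"
  unfolding admissible_def
proof (intro conjI impI)
  show "\<forall>t\<in>T. \<forall>xs. length xs = j \<and> set xs \<subseteq> {0..1} \<longrightarrow>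
      legal_program (V (owner d)) (program d t xs) 2 (P \<union> set xs) \<and>
      (knife d \<longrightarrow> device_fun V d t xs \<in> {0..1})"
    by (simp add: assms(1,2) del: atLeastAtMost_iff)
  show "\<forall>X. (\<forall>t\<in>T. length (X t) = j \<and> set (X t) \<subseteq> {0..1}) \<and>
      (\<forall>i<j. continuous_on T (\<lambda>t. X t ! i)) \<longrightarrow> continuous_on T (\<lambda>t. device_fun V d t (X t))"
  proof (intro allI impI)
    fix X :: "real \<Rightarrow> real list"
    assume X: "(\<forall>t\<in>T. length (X t) = j \<and> set (X t) \<subseteq> {0..1}) \<and>
      (\<forall>i<j. continuous_on T (\<lambda>t. X t ! i))"
    show "continuous_on T (\<lambda>t. device_fun V d t (X t))"
    proof (rule assms(3))
      fix t i assume "t \<in> T" "i < j"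
      then have "X t ! i \<in> set (X t)" "set (X t) \<subseteq> {0..1}"
        using X by auto
      then show "X t ! i \<in> {0..1}"
        by blast
    qed (use X in auto)
  qed
next
  assume "bounded_density (V (owner d))"
  then obtain L where L: "\<And>t u xs ys D. t \<in> T \<Longrightarrow> u \<in> T \<Longrightarrow> length xs = j \<Longrightarrow> length ys = j \<Longrightarrow>
        (\<forall>i<j. xs ! i \<in> {0..1} \<and> ys ! i \<in> {0..1} \<and> \<bar>xs ! i - ys ! i\<bar> \<le> D) \<Longrightarrow>
        \<bar>t - u\<bar> \<le> D \<Longrightarrow>
        \<bar>device_fun V d t xs - device_fun V d u ys\<bar> \<le> L * D"
    using assms(4) by blast
  show "\<exists>L. \<forall>t\<in>T. \<forall>u\<in>T. \<forall>xs ys.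
      length xs = j \<and> set xs \<subseteq> {0..1} \<and> length ys = j \<and> set ys \<subseteq> {0..1} \<longrightarrow>
      \<bar>device_fun V d t xs - device_fun V d u ys\<bar>
        \<le> L * (\<bar>t - u\<bar> + (\<Sum>i<j. \<bar>xs ! i - ys ! i\<bar>))"
  proof (intro exI ballI allI impI)
    fix t u and xs ys :: "real list"
    assume "t \<in> T" "u \<in> T"
      and *: "length xs = j \<and> set xs \<subseteq> {0..1} \<and> length ys = j \<and> set ys \<subseteq> {0..1}"
    \<comment> \<open>The whole sum of differences is taken as \<open>D\<close>: it dominates each
      of its non-negative summands.\<close>
    moreover have "\<forall>i<j. xs ! i \<in> {0..1} \<and> ys ! i \<in> {0..1} \<and>
        \<bar>xs ! i - ys ! i\<bar> \<le> \<bar>t - u\<bar> + (\<Sum>i<j. \<bar>xs ! i - ys ! i\<bar>)"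
    proof (intro allI impI)
      fix i assume "i < j"
      moreover from this have "xs ! i \<in> set xs" "ys ! i \<in> set ys"
        using * by auto
      ultimately show "xs ! i \<in> {0..1} \<and> ys ! i \<in> {0..1} \<and>
          \<bar>xs ! i - ys ! i\<bar> \<le> \<bar>t - u\<bar> + (\<Sum>i<j. \<bar>xs ! i - ys ! i\<bar>)"
        using * member_le_sum[of i "{..<j}" "\<lambda>i. \<bar>xs ! i - ys ! i\<bar>"]
        by (auto simp: subset_iff)
    qed
    moreover have "\<bar>t - u\<bar> \<le> \<bar>t - u\<bar> + (\<Sum>i<j. \<bar>xs ! i - ys ! i\<bar>)"
      by (simp add: sum_nonneg)
    ultimately show "\<bar>device_fun V d t xs - device_fun V d u ys\<bar>
        \<le> L * (\<bar>t - u\<bar> + (\<Sum>i<j. \<bar>xs ! i - ys ! i\<bar>))"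
      using L * by blast
  qed
qed

lemma admissibleD:
  assumes "admissible V P T j d"
  shows "t \<in> T \<Longrightarrow> length xs = j \<Longrightarrow> set xs \<subseteq> {0..1} \<Longrightarrow>
      legal_program (V (owner d)) (program d t xs) 2 (P \<union> set xs)"
    and "t \<in> T \<Longrightarrow> length xs = j \<Longrightarrow> set xs \<subseteq> {0..1} \<Longrightarrow> knife d \<Longrightarrow>
      device_fun V d t xs \<in> {0..1}"
    and "\<forall>t\<in>T. length (X t) = j \<and> set (X t) \<subseteq> {0..1} \<Longrightarrow>
      \<forall>i<j. continuous_on T (\<lambda>t. X t ! i) \<Longrightarrow>
      continuous_on T (\<lambda>t. device_fun V d t (X t))"
    and "bounded_density (V (owner d)) \<Longrightarrow>
      \<exists>L. \<forall>t\<in>T. \<forall>u\<in>T. \<forall>xs ys.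
           length xs = j \<and> set xs \<subseteq> {0..1} \<and> length ys = j \<and> set ys \<subseteq> {0..1} \<longrightarrow>
           \<bar>device_fun V d t xs - device_fun V d u ys\<bar>
             \<le> L * (\<bar>t - u\<bar> + (\<Sum>i<j. \<bar>xs ! i - ys ! i\<bar>))"
  using assms by (simp_all add: admissible_def del: atLeastAtMost_iff)

section \<open>Admissibility of the individual devices\<close>

lemma admissible_time_knife: "T \<subseteq> {0..1} \<Longrightarrow> admissible V P T 0 time_knife"
  by (rule admissibleI) (auto simp: time_knife_def device_fun_def intro!: exI[of _ 1])

lemma admissible_copy_knife:
  assumes "j > 0"
  shows "admissible V P T j copy_knife"
proof (rule admissibleI)
  fix t and xs :: "real list"
  assume "length xs = j" "set xs \<subseteq> {0..1}"
  then show "device_fun V copy_knife t xs \<in> {0..1}"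
    using assms nth_mem[of 0 xs] by (simp add: copy_knife_def device_fun_def subset_iff)
next
  show "\<exists>L. \<forall>t u xs ys D. t \<in> T \<longrightarrow> u \<in> T \<longrightarrow> length xs = j \<longrightarrow> length ys = j \<longrightarrow>
        (\<forall>i<j. xs ! i \<in> {0..1} \<and> ys ! i \<in> {0..1} \<and> \<bar>xs ! i - ys ! i\<bar> \<le> D) \<longrightarrow>
        \<bar>t - u\<bar> \<le> D \<longrightarrow>
        \<bar>device_fun V copy_knife t xs - device_fun V copy_knife u ys\<bar> \<le> L * D"
    using assms by (intro exI[of _ 1]) (simp add: copy_knife_def device_fun_def)
qed (use assms in \<open>simp_all add: copy_knife_def device_fun_def\<close>)

lemma continuous_on_cum_compose:
  assumes "hungry v" "continuous_on T f" "\<And>t. t \<in> T \<Longrightarrow> f t \<in> {0..1}"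
  shows "continuous_on T (\<lambda>t. cum v (f t))"
  using continuous_on_compose2[OF continuous_on_cum[OF assms(1)] assms(2)] assms(3) by blast

lemma continuous_on_cut_point_compose:
  assumes "hungry v" "continuous_on T f" "\<And>t. t \<in> T \<Longrightarrow> f t \<in> {0..1}"
  shows "continuous_on T (\<lambda>t. cut_point v (f t))"
  using continuous_on_compose2[OF continuous_on_cut_point[OF assms(1)] assms(2)] assms(3) by blast

lemma last_eq_nth: "length xs = j \<Longrightarrow> 0 < j \<Longrightarrow> last xs = xs ! (j - 1)"
  by (auto simp: last_conv_nth)

lemma continuous_on_last:
  assumes "j > 0" "\<And>t. t \<in> T \<Longrightarrow> length (X t) = j" "\<And>i. i < j \<Longrightarrow> continuous_on T (\<lambda>t. X t ! i)"
  shows "continuous_on T (\<lambda>t. last (X t))"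
proof -
  have "continuous_on T (\<lambda>t. X t ! (j - 1))"
    using assms by simp
  then show ?thesis
    by (rule continuous_on_eq) (use assms in \<open>simp add: last_eq_nth\<close>)
qed

lemma last_in_cake:
  assumes "length xs = j" "0 < j" "set xs \<subseteq> {0..1::real}"
  shows "last xs \<in> set xs \<and> last xs \<in> {0..1}"
proof -
  have "last xs \<in> set xs"
    using assms(1,2) by (intro last_in_set) auto
  then show ?thesis
    using assms(3) by blast
qed

lemma admissible_rest_knife:
  assumes v: "hungry (V n)" and j: "j > 0"
  shows "admissible V P T j (rest_knife n)"
proof (rule admissibleI)
  fix X :: "real \<Rightarrow> real list"
  assume X: "\<And>t. t \<in> T \<Longrightarrow> length (X t) = j" "\<And>t i. t \<in> T \<Longrightarrow> i < j \<Longrightarrow> X t ! i \<in> {0..1}"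
    "\<And>i. i < j \<Longrightarrow> continuous_on T (\<lambda>t. X t ! i)"
  then have "continuous_on T (\<lambda>t. cum (V n) (last (X t)))"
    using j by (intro continuous_on_cum_compose[OF v] continuous_on_last[OF j])
      (auto simp: last_eq_nth)
  then show "continuous_on T (\<lambda>t. device_fun V (rest_knife n) t (X t))"
    by (simp add: rest_knife_def device_fun_def)
next
  assume "bounded_density (V (owner (rest_knife n)))"
  then have "bounded_density (V n)"
    by (simp add: rest_knife_def)
  then obtain B where B: "B \<ge> 0"
    "\<And>x y. x \<in> {0..1} \<Longrightarrow> y \<in> {0..1} \<Longrightarrow> \<bar>cum (V n) x - cum (V n) y\<bar> \<le> B * \<bar>x - y\<bar>"
    "\<And>x y. x \<in> {0..1} \<Longrightarrow> y \<in> {0..1} \<Longrightarrow> \<bar>cut_point (V n) x - cut_point (V n) y\<bar> \<le> B * \<bar>x - y\<bar>"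
    using bounded_density_lipschitz[OF v] by blast
  show "\<exists>L. \<forall>t u xs ys D. t \<in> T \<longrightarrow> u \<in> T \<longrightarrow> length xs = j \<longrightarrow> length ys = j \<longrightarrow>
        (\<forall>i<j. xs ! i \<in> {0..1} \<and> ys ! i \<in> {0..1} \<and> \<bar>xs ! i - ys ! i\<bar> \<le> D) \<longrightarrow>
        \<bar>t - u\<bar> \<le> D \<longrightarrow>
        \<bar>device_fun V (rest_knife n) t xs - device_fun V (rest_knife n) u ys\<bar> \<le> L * D"
  proof (intro exI allI impI)
    fix t u D :: real and xs ys :: "real list"
    assume *: "length xs = j" "length ys = j"
      "\<forall>i<j. xs ! i \<in> {0..1} \<and> ys ! i \<in> {0..1} \<and> \<bar>xs ! i - ys ! i\<bar> \<le> D"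
    then have "\<bar>cum (V n) (last xs) - cum (V n) (last ys)\<bar> \<le> B * \<bar>last xs - last ys\<bar>"
      using j by (intro B) (auto simp: last_eq_nth)
    also have "\<dots> \<le> B * D"
      using * j B(1) by (intro mult_left_mono) (auto simp: last_eq_nth)
    finally show "\<bar>device_fun V (rest_knife n) t xs - device_fun V (rest_knife n) u ys\<bar> \<le> B * D"
      by (simp add: rest_knife_def device_fun_def)
  qed
next
  fix xs :: "real list"
  assume "length xs = j" "set xs \<subseteq> {0..1}"
  then show "legal_program (V (owner (rest_knife n))) (program (rest_knife n) t xs) 2 (P \<union> set xs)"
    and "device_fun V (rest_knife n) t xs \<in> {0..1}" for t
    using last_in_cake[of xs j] j cum_range[OF v, of "last xs"]
    by (auto simp: rest_knife_def device_fun_def)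
qed

text \<open>Without earlier cuts the device evaluates at the moving knife. Otherwise it is constant,
  with Lipschitz constant 0, and legal because \<open>hd ts\<close> is an earlier cut point.\<close>

lemma admissible_first_value_knife:
  assumes v: "hungry (V 1)" and j: "j > 0" and ts: "set ts \<subseteq> P \<inter> {0..1}"
  shows "admissible V P T j (first_value_knife ts)"
proof (cases ts)
  case Nil
  show ?thesis
  proof (rule admissibleI)
    fix X :: "real \<Rightarrow> real list"
    assume X: "\<And>t. t \<in> T \<Longrightarrow> length (X t) = j" "\<And>t i. t \<in> T \<Longrightarrow> i < j \<Longrightarrow> X t ! i \<in> {0..1}"
      "\<And>i. i < j \<Longrightarrow> continuous_on T (\<lambda>t. X t ! i)"
    then have "continuous_on T (\<lambda>t. cum (V 1) (X t ! 0))"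
      using j by (intro continuous_on_cum_compose[OF v]) auto
    then show "continuous_on T (\<lambda>t. device_fun V (first_value_knife ts) t (X t))"
      by (simp add: first_value_knife_def device_fun_def Nil)
  next
    assume "bounded_density (V (owner (first_value_knife ts)))"
    then have "bounded_density (V 1)"
      by (simp add: first_value_knife_def)
    then obtain B where B: "B \<ge> 0"
      "\<And>x y. x \<in> {0..1} \<Longrightarrow> y \<in> {0..1} \<Longrightarrow> \<bar>cum (V 1) x - cum (V 1) y\<bar> \<le> B * \<bar>x - y\<bar>"
      "\<And>x y. x \<in> {0..1} \<Longrightarrow> y \<in> {0..1} \<Longrightarrow> \<bar>cut_point (V 1) x - cut_point (V 1) y\<bar> \<le> B * \<bar>x - y\<bar>"
      using bounded_density_lipschitz[OF v] by blast
    show "\<exists>L. \<forall>t u xs ys D. t \<in> T \<longrightarrow> u \<in> T \<longrightarrow> length xs = j \<longrightarrow> length ys = j \<longrightarrow>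
          (\<forall>i<j. xs ! i \<in> {0..1} \<and> ys ! i \<in> {0..1} \<and> \<bar>xs ! i - ys ! i\<bar> \<le> D) \<longrightarrow>
          \<bar>t - u\<bar> \<le> D \<longrightarrow>
          \<bar>device_fun V (first_value_knife ts) t xs - device_fun V (first_value_knife ts) u ys\<bar> \<le> L * D"
    proof (intro exI allI impI)
      fix t u D :: real and xs ys :: "real list"
      assume *: "length xs = j" "length ys = j"
        "\<forall>i<j. xs ! i \<in> {0..1} \<and> ys ! i \<in> {0..1} \<and> \<bar>xs ! i - ys ! i\<bar> \<le> D"
      then have "\<bar>cum (V 1) (xs ! 0) - cum (V 1) (ys ! 0)\<bar> \<le> B * \<bar>xs ! 0 - ys ! 0\<bar>"
        using j by (intro B) auto
      also have "\<dots> \<le> B * D"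
        using * j B(1) by (intro mult_left_mono) auto
      finally show "\<bar>device_fun V (first_value_knife ts) t xs - device_fun V (first_value_knife ts) u ys\<bar> \<le> B * D"
        by (simp add: first_value_knife_def device_fun_def Nil)
    qed
  next
    fix xs :: "real list"
    assume xs: "length xs = j" "set xs \<subseteq> {0..1}"
    then have "xs ! 0 \<in> set xs" "xs ! 0 \<in> {0..1}"
      using j nth_mem by blast+
    then show "legal_program (V (owner (first_value_knife ts))) (program (first_value_knife ts) t xs) 2 (P \<union> set xs)"
      and "device_fun V (first_value_knife ts) t xs \<in> {0..1}" for t
      using cum_range[OF v, of "xs ! 0"] by (auto simp: first_value_knife_def device_fun_def Nil)
  qed
next
  case (Cons a as)
  then have "a \<in> P" "a \<in> {0..1}"
    using ts by auto
  then show ?thesis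
    using cum_range[OF v, of a]
    by - (rule admissibleI; auto simp: first_value_knife_def device_fun_def Cons intro!: exI[of _ 0])
qed

text \<open>The sum of \<open>c\<close> and an evaluation has Lipschitz constant
  \<open>1 + B\<close>, clipping does not increase it, and the final cut contributes another factor
  \<open>B\<close>.\<close>

lemma admissible_chain_knife:
  assumes v: "hungry (V m)" and j: "j > 1"
  shows "admissible V P T j (chain_knife m)"
proof (rule admissibleI)
  fix X :: "real \<Rightarrow> real list"
  assume X: "\<And>t. t \<in> T \<Longrightarrow> length (X t) = j" "\<And>t i. t \<in> T \<Longrightarrow> i < j \<Longrightarrow> X t ! i \<in> {0..1}"
    "\<And>i. i < j \<Longrightarrow> continuous_on T (\<lambda>t. X t ! i)"
  then have "continuous_on T (\<lambda>t. cum (V m) (last (X t)))"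
    using j by (intro continuous_on_cum_compose[OF v] continuous_on_last[of j])
      (auto simp: last_eq_nth)
  then have "continuous_on T (\<lambda>t. cut_point (V m) (clip (X t ! 1 + cum (V m) (last (X t)))))"
    using j X(3) by (intro continuous_on_cut_point_compose[OF v] continuous_intros) auto
  then show "continuous_on T (\<lambda>t. device_fun V (chain_knife m) t (X t))"
    by (simp add: chain_knife_def device_fun_def)
next
  assume "bounded_density (V (owner (chain_knife m)))"
  then have "bounded_density (V m)"
    by (simp add: chain_knife_def)
  then obtain B where B: "B \<ge> 0"
    "\<And>x y. x \<in> {0..1} \<Longrightarrow> y \<in> {0..1} \<Longrightarrow> \<bar>cum (V m) x - cum (V m) y\<bar> \<le> B * \<bar>x - y\<bar>"
    "\<And>x y. x \<in> {0..1} \<Longrightarrow> y \<in> {0..1} \<Longrightarrow> \<bar>cut_point (V m) x - cut_point (V m) y\<bar> \<le> B * \<bar>x - y\<bar>"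
    using bounded_density_lipschitz[OF v] by blast
  show "\<exists>L. \<forall>t u xs ys D. t \<in> T \<longrightarrow> u \<in> T \<longrightarrow> length xs = j \<longrightarrow> length ys = j \<longrightarrow>
        (\<forall>i<j. xs ! i \<in> {0..1} \<and> ys ! i \<in> {0..1} \<and> \<bar>xs ! i - ys ! i\<bar> \<le> D) \<longrightarrow>
        \<bar>t - u\<bar> \<le> D \<longrightarrow>
        \<bar>device_fun V (chain_knife m) t xs - device_fun V (chain_knife m) u ys\<bar> \<le> L * D"
  proof (intro exI allI impI)
    fix t u D :: real and xs ys :: "real list"
    assume *: "length xs = j" "length ys = j"
      "\<forall>i<j. xs ! i \<in> {0..1} \<and> ys ! i \<in> {0..1} \<and> \<bar>xs ! i - ys ! i\<bar> \<le> D"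
    let ?x = "xs ! 1 + cum (V m) (last xs)" and ?y = "ys ! 1 + cum (V m) (last ys)"
    have "\<bar>cum (V m) (last xs) - cum (V m) (last ys)\<bar> \<le> B * \<bar>last xs - last ys\<bar>"
      using * j by (intro B) (auto simp: last_eq_nth)
    also have "\<dots> \<le> B * D"
      using * j B(1) by (intro mult_left_mono) (auto simp: last_eq_nth)
    finally have "\<bar>?x - ?y\<bar> \<le> D + B * D"
      using *(3) j by (smt (verit, best))
    then have "B * \<bar>clip ?x - clip ?y\<bar> \<le> B * (D + B * D)"
      using B(1) clip_lipschitz[of ?x ?y] by (intro mult_left_mono) auto
    moreover have "\<bar>cut_point (V m) (clip ?x) - cut_point (V m) (clip ?y)\<bar> \<le> B * \<bar>clip ?x - clip ?y\<bar>"
      by (intro B) simp_all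
    ultimately show "\<bar>device_fun V (chain_knife m) t xs - device_fun V (chain_knife m) u ys\<bar> \<le> (B * (1 + B)) * D"
      by (simp add: chain_knife_def device_fun_def algebra_simps)
  qed
next
  fix xs :: "real list"
  assume "length xs = j" "set xs \<subseteq> {0..1}"
  then show "legal_program (V (owner (chain_knife m))) (program (chain_knife m) t xs) 2 (P \<union> set xs)"
    and "device_fun V (chain_knife m) t xs \<in> {0..1}" for t
    using last_in_cake[of xs j] j cut_point_range[of "V m", OF v clip_range(1)]
    by (simp_all add: chain_knife_def device_fun_def)
qed

text \<open>The convention \<open>last (0 # ts)\<close> merges the two cases of the second query,
  since the answer to \<open>Cut 0\<close> equals the value of the degenerate interval at 0.\<close>

lemma device_fun_final_trigger:
  assumes v: "hungry (V (Suc (length ts)))"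
  shows "device_fun V (final_trigger n ts) t xs =
    2 * real n * (cum (V (Suc (length ts))) (xs ! 0) - cum (V (Suc (length ts))) (last (0 # ts)) - 1 + last xs)"
  using cut_point_0[OF v] by (cases "ts = []") (simp_all add: final_trigger_def device_fun_def)

text \<open>The value at the previous cut depends neither on the time nor on the devices, so it
  cancels from differences. Its query is legal because \<open>last ts\<close> already belongs to
  \<open>P\<close>.\<close>

lemma admissible_final_trigger:
  assumes v: "hungry (V (Suc (length ts)))" and j: "j > 0" and ts: "set ts \<subseteq> P \<inter> {0..1}"
  shows "admissible V P T j (final_trigger n ts)"
proof (rule admissibleI)
  let ?v = "V (Suc (length ts))"
  fix X :: "real \<Rightarrow> real list"
  assume X: "\<And>t. t \<in> T \<Longrightarrow> length (X t) = j" "\<And>t i. t \<in> T \<Longrightarrow> i < j \<Longrightarrow> X t ! i \<in> {0..1}"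
    "\<And>i. i < j \<Longrightarrow> continuous_on T (\<lambda>t. X t ! i)"
  then have "continuous_on T (\<lambda>t. cum ?v (X t ! 0))"
    using j by (intro continuous_on_cum_compose[OF v]) auto
  then show "continuous_on T (\<lambda>t. device_fun V (final_trigger n ts) t (X t))"
    unfolding device_fun_final_trigger[of V ts, OF v]
    using X j by (intro continuous_intros continuous_on_last[of j])
next
  let ?v = "V (Suc (length ts))"
  assume "bounded_density (V (owner (final_trigger n ts)))"
  then have "bounded_density ?v"
    by (simp add: final_trigger_def)
  then obtain B where B: "B \<ge> 0"
    "\<And>x y. x \<in> {0..1} \<Longrightarrow> y \<in> {0..1} \<Longrightarrow> \<bar>cum ?v x - cum ?v y\<bar> \<le> B * \<bar>x - y\<bar>"
    "\<And>x y. x \<in> {0..1} \<Longrightarrow> y \<in> {0..1} \<Longrightarrow> \<bar>cut_point ?v x - cut_point ?v y\<bar> \<le> B * \<bar>x - y\<bar>"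
    using bounded_density_lipschitz[OF v] by blast
  show "\<exists>L. \<forall>t u xs ys D. t \<in> T \<longrightarrow> u \<in> T \<longrightarrow> length xs = j \<longrightarrow> length ys = j \<longrightarrow>
        (\<forall>i<j. xs ! i \<in> {0..1} \<and> ys ! i \<in> {0..1} \<and> \<bar>xs ! i - ys ! i\<bar> \<le> D) \<longrightarrow>
        \<bar>t - u\<bar> \<le> D \<longrightarrow>
        \<bar>device_fun V (final_trigger n ts) t xs - device_fun V (final_trigger n ts) u ys\<bar> \<le> L * D"
  proof (intro exI allI impI)
    fix t u D :: real and xs ys :: "real list"
    assume *: "length xs = j" "length ys = j"
      "\<forall>i<j. xs ! i \<in> {0..1} \<and> ys ! i \<in> {0..1} \<and> \<bar>xs ! i - ys ! i\<bar> \<le> D"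
    have "\<bar>cum ?v (xs ! 0) - cum ?v (ys ! 0)\<bar> \<le> B * \<bar>xs ! 0 - ys ! 0\<bar>"
      using * j by (intro B) auto
    also have "\<dots> \<le> B * D"
      using * j B(1) by (intro mult_left_mono) auto
    finally have "\<bar>(cum ?v (xs ! 0) - cum ?v (ys ! 0)) + (last xs - last ys)\<bar> \<le> B * D + D"
      using *(3)[rule_format, of "j - 1"] j
      unfolding last_eq_nth[OF *(1) j] last_eq_nth[OF *(2) j] by linarith
    then have "2 * real n * \<bar>(cum ?v (xs ! 0) - cum ?v (ys ! 0)) + (last xs - last ys)\<bar> \<le> 2 * real n * (B * D + D)"
      by (intro mult_left_mono) auto
    moreover have "device_fun V (final_trigger n ts) t xs - device_fun V (final_trigger n ts) u ys
        = 2 * real n * ((cum ?v (xs ! 0) - cum ?v (ys ! 0)) + (last xs - last ys))"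
      unfolding device_fun_final_trigger[of V ts, OF v] by (simp add: algebra_simps)
    ultimately show "\<bar>device_fun V (final_trigger n ts) t xs - device_fun V (final_trigger n ts) u ys\<bar> \<le> (2 * real n * (B + 1)) * D"
      by (simp only: abs_mult) (simp add: algebra_simps)
  qed
next
  fix xs :: "real list"
  assume "length xs = j" "set xs \<subseteq> {0..1}"
  then have "xs ! 0 \<in> set xs" "xs ! 0 \<in> {0..1}"
    using j nth_mem by blast+
  moreover have "last ts \<in> P \<inter> {0..1}" if "ts \<noteq> []"
    using ts last_in_set[OF that] by blast
  ultimately show "legal_program (V (owner (final_trigger n ts))) (program (final_trigger n ts) t xs) 2 (P \<union> set xs)" for t
    by (simp add: final_trigger_def)
qed (simp add: final_trigger_def)


section \<open>Steps with a single trigger\<close>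

lemma length_device_values [simp]: "length (device_values V s t) = length (devices s)"
proof -
  have "length (foldl (\<lambda>xs d. xs @ [device_fun V d t xs]) [] ds) = length ds" for ds
    by (induction ds rule: rev_induct) auto
  then show ?thesis
    by (simp add: device_values_def)
qed

text \<open>Turns the fold into a recursion on the index: appending further devices never changes
  earlier values.\<close>

lemma device_values_nth:
  assumes "j < length (devices s)"
  shows "device_values V s t ! j = device_fun V (devices s ! j) t (take j (device_values V s t))"
proof -
  define vals where "vals ds = foldl (\<lambda>xs d. xs @ [device_fun V d t xs]) [] ds" for ds
  have len: "length (vals ds) = length ds" for ds
    unfolding vals_def by (induction ds rule: rev_induct) auto
  have vals_snoc: "vals (ds @ [d]) = vals ds @ [device_fun V d t (vals ds)]" for ds d
    by (simp add: vals_def)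
  have "vals ds ! j = device_fun V (ds ! j) t (take j (vals ds))" if "j < length ds" for ds
    using that
  proof (induction ds rule: rev_induct)
    case (snoc d ds)
    then show ?case
      by (cases "j < length ds") (auto simp: vals_snoc len nth_append)
  qed simp
  from this[OF assms] show ?thesis
    by (simp add: device_values_def vals_def)
qed

text \<open>Conditions on a step that can be checked device by device; from them follow its
  legality, the uniqueness of its trigger and the existence of an exact outcome.\<close>

locale single_trigger_step =
  fixes V :: profile and n :: nat and P :: "real set" and s :: knife_step and ks tr
  assumes devices: "devices s = ks @ [tr]"
    and knives: "\<And>d. d \<in> set ks \<Longrightarrow> knife d" and not_knife: "\<not> knife tr"
    and times: "0 \<le> start s" "start s \<le> stop s" "stop s \<le> 1"
    and first: "ks \<noteq> []" "hd ks = time_knife"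
    and owners: "\<And>d. d \<in> set (devices s) \<Longrightarrow> owner d \<in> {1..n}"
    and admissible: "\<And>j. j < length (devices s) \<Longrightarrow>
      admissible V P {start s..stop s} j (devices s ! j)"
    and sign_change: "last (device_values V s (start s)) * last (device_values V s (stop s)) \<le> 0"
begin

lemma knife_nth: "knife (devices s ! i)" if "i < length ks"
  using knives[of "ks ! i"] that by (simp add: devices nth_append)

lemma knife_positions_eq:
  assumes "length xs \<le> length ks"
  shows "knife_positions s xs = set xs"
  using assms knife_nth by (auto simp: knife_positions_def set_conv_nth)

lemma device_domain_eq:
  assumes "j \<le> length ks"
  shows "device_domain s j = {(t, xs). t \<in> {start s..stop s} \<and> length xs = j \<and> set xs \<subseteq> {0..1}}"
  using assms by (auto simp: device_domain_def knife_positions_eq)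

lemma last_device_values: "last (device_values V s t) = device_values V s t ! length ks"
proof -
  have "device_values V s t \<noteq> []"
    using length_device_values[of V s t] by (auto simp: devices simp del: length_device_values)
  then show ?thesis
    by (simp add: last_conv_nth devices)
qed

lemma active_trigger_iff: "active_trigger V s j \<longleftrightarrow> j = length ks"
  using sign_change not_knife knife_nth
  by (auto simp: active_trigger_def last_device_values devices nth_append less_Suc_eq)

text \<open>Continuity and range are proved together by strong induction, because continuity of
  device \<open>j\<close> is only known along curves of preceding values in the unit interval. The
  range is claimed for knives only; every device before \<open>j\<close> is one.\<close>

lemma device_values_behaviour:
  assumes "j < length (devices s)"
  shows "continuous_on {start s..stop s} (\<lambda>t. device_values V s t ! j) \<and>
    (j < length ks \<longrightarrow> (\<forall>t\<in>{start s..stop s}. device_values V s t ! j \<in> {0..1}))"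
  using assms
proof (induction j rule: less_induct)
  case (less j)
  let ?X = "\<lambda>t. take j (device_values V s t)" and ?d = "devices s ! j"
  have IH: "continuous_on {start s..stop s} (\<lambda>t. device_values V s t ! i)"
    "\<And>t. t \<in> {start s..stop s} \<Longrightarrow> device_values V s t ! i \<in> {0..1}" if "i < j" for i
    using less.IH[of i] less.prems that by (auto simp: devices)
  have X: "length (?X t) = j \<and> set (?X t) \<subseteq> {0..1}" if t: "t \<in> {start s..stop s}" for t
  proof
    show "length (?X t) = j"
      using less.prems by simp
    show "set (?X t) \<subseteq> {0..1}"
    proof
      fix x assume "x \<in> set (?X t)"
      then obtain i where "i < j" "x = device_values V s t ! i"
        by (auto simp: set_conv_nth)
      then show "x \<in> {0..1}"
        using IH(2)[OF _ t] by simp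
    qed
  qed
  have "continuous_on {start s..stop s} (\<lambda>t. device_fun V ?d t (?X t))"
  proof (rule admissibleD(3)[OF admissible[OF less.prems]])
    show "\<forall>t\<in>{start s..stop s}. length (?X t) = j \<and> set (?X t) \<subseteq> {0..1}"
      using X by blast
    show "\<forall>i<j. continuous_on {start s..stop s} (\<lambda>t. ?X t ! i)"
      using IH(1) by simp
  qed
  moreover have "device_fun V ?d t (?X t) \<in> {0..1}" if "j < length ks" "t \<in> {start s..stop s}" for t
    using admissibleD(2)[OF admissible[OF less.prems] that(2)] X[OF that(2)] knife_nth[OF that(1)]
    by simp
  ultimately show ?case
    using device_values_nth[OF less.prems] by simp
qed

lemma legal_device:
  assumes "j < length (devices s)"
  shows "legal_device V 2 P s j"
proof -
  have j: "j \<le> length ks"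
    using assms by (simp add: devices)
  note adm = admissibleD[OF admissible[OF assms]]
  show ?thesis
    unfolding legal_device_def Let_def lipschitz_device_def device_domain_eq[OF j]
  proof (intro conjI ballI, goal_cases)
    case (1 x)
    then obtain t xs where "x = (t, xs)" "t \<in> {start s..stop s}" "length xs = j" "set xs \<subseteq> {0..1}"
      by blast
    then show ?case
      using adm(1,2)[of t xs] j by (simp add: knife_positions_eq del: atLeastAtMost_iff)
  next
    case 2
    show ?case
      using device_values_behaviour[OF assms] by blast
  next
    case 3
    show ?case
    proof
      assume "bounded_density (V (owner (devices s ! j)))"
      then obtain L where L: "\<forall>t\<in>{start s..stop s}. \<forall>u\<in>{start s..stop s}. \<forall>xs ys.
           length xs = j \<and> set xs \<subseteq> {0..1} \<and> length ys = j \<and> set ys \<subseteq> {0..1} \<longrightarrow>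
           \<bar>device_fun V (devices s ! j) t xs - device_fun V (devices s ! j) u ys\<bar>
             \<le> L * (\<bar>t - u\<bar> + (\<Sum>i<j. \<bar>xs ! i - ys ! i\<bar>))"
        using adm(4) by blast
      show "\<exists>L. \<forall>(t, xs)\<in>{(t, xs). t \<in> {start s..stop s} \<and> length xs = j \<and> set xs \<subseteq> {0..1}}.
          \<forall>(u, ys)\<in>{(t, xs). t \<in> {start s..stop s} \<and> length xs = j \<and> set xs \<subseteq> {0..1}}.
            \<bar>device_fun V (devices s ! j) t xs - device_fun V (devices s ! j) u ys\<bar>
              \<le> L * (\<bar>t - u\<bar> + (\<Sum>i<j. \<bar>xs ! i - ys ! i\<bar>))"
      proof (rule exI[of _ L], clarify)
        fix t u :: real and xs ys :: "real list"
        assume "t \<in> {start s..stop s}" "u \<in> {start s..stop s}"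
          "set xs \<subseteq> {0..1}" "j = length xs" "length ys = length xs" "set ys \<subseteq> {0..1}"
        then show "\<bar>device_fun V (devices s ! length xs) t xs - device_fun V (devices s ! length xs) u ys\<bar>
            \<le> L * (\<bar>t - u\<bar> + (\<Sum>i<length xs. \<bar>xs ! i - ys ! i\<bar>))"
          using L by blast
      qed
    qed
  qed
qed

lemma legal_step:
  assumes "length (devices s) \<le> K"
  shows "legal_step n V K 2 P s"
proof -
  have "devices s ! 0 = time_knife"
    using first by (cases ks) (auto simp: devices)
  then show ?thesis
    unfolding legal_step_def
    using assms times legal_device owners active_trigger_iff devices
    by (auto simp: time_knife_def device_fun_def)
qed

lemma eps_outcomeD:
  assumes "eps_outcome V \<epsilon> s (j, t, xs)"
  shows "t \<in> {start s..stop s}" "\<bar>last (device_values V s t)\<bar> \<le> \<epsilon>"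
  using assms by (auto simp: active_trigger_iff last_device_values)

text \<open>The intermediate value theorem for the last device, in either direction of the sign
  change.\<close>

lemma exact_outcome_exists: "\<exists>x. eps_outcome V 0 s x"
proof -
  let ?f = "\<lambda>t. device_values V s t ! length ks"
  have "continuous_on {start s..stop s} ?f"
    using device_values_behaviour[of "length ks"] by (simp add: devices)
  moreover have "?f (start s) * ?f (stop s) \<le> 0"
    using sign_change by (simp add: last_device_values)
  then have "?f (start s) \<le> 0 \<and> 0 \<le> ?f (stop s) \<or> ?f (stop s) \<le> 0 \<and> 0 \<le> ?f (start s)"
    by (auto simp: mult_le_0_iff)
  ultimately obtain t where "start s \<le> t" "t \<le> stop s" "?f t = 0"
    using IVT'[of ?f "start s" 0 "stop s"] IVT2'[of ?f "stop s" 0 "start s"] times(2) by blast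
  then have "eps_outcome V 0 s (length ks, t, device_values V s t)"
    by (simp add: active_trigger_iff)
  then show ?thesis ..
qed

end


section \<open>The steps of the protocol\<close>

text \<open>Given the position \<open>y\<close> of a cut, the chain places the cuts that would give each of the
  players \<open>js\<close> in turn a piece of value \<open>c\<close>, or whatever is left if that is worth less.\<close>

definition chain :: "profile \<Rightarrow> real \<Rightarrow> nat list \<Rightarrow> real \<Rightarrow> real" where
  "chain V c js y = foldl (\<lambda>y j. cut_point (V j) (clip (c + cum (V j) y))) y js"

lemma chain_Nil [simp]: "chain V c [] y = y"
  and chain_Cons [simp]: "chain V c (j # js) y = chain V c js (cut_point (V j) (clip (c + cum (V j) y)))"
  by (simp_all add: chain_def)

lemma chain_range:
  assumes "\<And>j. j \<in> set js \<Longrightarrow> hungry (V j)" "y \<in> {0..1}"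
  shows "chain V c js y \<in> {0..1}"
  using assms
proof (induction js arbitrary: y)
  case (Cons j js)
  have "chain V c js (cut_point (V j) (clip (c + cum (V j) y))) \<in> {0..1}"
    using Cons.prems by (intro Cons.IH cut_point_range) auto
  then show ?case
    by simp
qed simp

lemma chain_mono:
  assumes "\<And>j. j \<in> set js \<Longrightarrow> hungry (V j)" "0 \<le> y" "y \<le> z" "z \<le> 1"
  shows "chain V c js y \<le> chain V c js z"
  using assms
proof (induction js arbitrary: y z)
  case (Cons j js)
  have j: "hungry (V j)"
    using Cons.prems by simp
  have "cut_point (V j) (clip (c + cum (V j) y)) \<le> cut_point (V j) (clip (c + cum (V j) z))"
    using Cons.prems by (intro cut_point_mono clip_mono add_left_mono cum_mono j) auto
  then have "chain V c js (cut_point (V j) (clip (c + cum (V j) y)))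
      \<le> chain V c js (cut_point (V j) (clip (c + cum (V j) z)))"
    using Cons.prems cut_point_range[OF j clip_range(1)] by (intro Cons.IH) auto
  then show ?case
    by simp
qed simp

text \<open>At the right end nothing is left, so clipping keeps every further cut at 1.\<close>

lemma chain_1:
  assumes "\<And>j. j \<in> set js \<Longrightarrow> hungry (V j)" "0 \<le> c"
  shows "chain V c js 1 = 1"
  using assms by (induction js) (auto simp: clip_def cut_point_1)

text \<open>The player served by this step is \<open>Suc (length ts)\<close>; the chain consists of
  the players strictly between that one and \<open>n\<close>.\<close>

definition step_knives :: "nat \<Rightarrow> real list \<Rightarrow> device list" where
  "step_knives n ts = [time_knife, first_value_knife ts, copy_knife] @
     map chain_knife [length ts + 2..<n] @ [rest_knife n]"

text \<open>Starting at the previous cut keeps the list of cuts sorted.\<close>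

definition cut_step :: "nat \<Rightarrow> real list \<Rightarrow> knife_step" where
  "cut_step n ts = \<lparr>start = last (0 # ts), stop = 1,
     devices = step_knives n ts @ [final_trigger n ts]\<rparr>"

lemma cut_step_simps [simp]:
  "start (cut_step n ts) = last (0 # ts)" "stop (cut_step n ts) = 1"
  "devices (cut_step n ts) = step_knives n ts @ [final_trigger n ts]"
  by (simp_all add: cut_step_def)

text \<open>This is \<open>f - g\<close> from the introduction, before scaling. The value
  \<open>c\<close> cancels between the two excesses but survives inside the chain; in the first step
  it varies with \<open>t\<close>.\<close>

definition gap :: "profile \<Rightarrow> nat \<Rightarrow> real list \<Rightarrow> real \<Rightarrow> real" where
  "gap V n ts t = cum (V (Suc (length ts))) t - cum (V (Suc (length ts))) (last (0 # ts)) - 1 +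
     cum (V n) (chain V (cum (V 1) (hd (ts @ [t]))) [length ts + 2..<n] t)"

lemma foldl_chain_knives:
  fixes V :: profile and t :: real and js :: "nat list" and xs :: "real list"
  assumes "length xs \<ge> 2"
  defines "ys \<equiv> foldl (\<lambda>xs d. xs @ [device_fun V d t xs]) xs (map chain_knife js)"
  shows "length ys \<ge> 2 \<and> ys ! 0 = xs ! 0 \<and> ys ! 1 = xs ! 1 \<and> last ys = chain V (xs ! 1) js (last xs)"
  unfolding ys_def using assms(1)
proof (induction js arbitrary: xs)
  case (Cons j js)
  have "device_fun V (chain_knife j) t xs = cut_point (V j) (clip (xs ! 1 + cum (V j) (last xs)))"
    by (simp add: chain_knife_def device_fun_def)
  moreover have "xs \<noteq> []"
    using Cons.prems by auto
  ultimately show ?case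
    using Cons.IH[of "xs @ [device_fun V (chain_knife j) t xs]"] Cons.prems
    by (simp add: nth_append)
qed simp

lemma last_device_values_cut_step:
  assumes "hungry (V (Suc (length ts)))"
  shows "last (device_values V (cut_step n ts) t) = 2 * real n * gap V n ts t"
proof -
  let ?ext = "\<lambda>xs d. xs @ [device_fun V d t xs]"
  define c where "c = cum (V 1) (hd (ts @ [t]))"
  \<comment> \<open>The list \<open>[t, c, t]\<close> holds the values of the time, first value and
    copy knives, with which the chain starts.\<close>
  define ys where "ys = foldl ?ext [t, c, t] (map chain_knife [length ts + 2..<n])"
  have ys: "length ys \<ge> 2" "ys ! 0 = t" "last ys = chain V c [length ts + 2..<n] t"
    using foldl_chain_knives[of "[t, c, t]" V t "[length ts + 2..<n]"] by (simp_all add: ys_def)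
  then have "ys \<noteq> []"
    by auto
  have "foldl ?ext [] [time_knife, first_value_knife ts, copy_knife] = [t, c, t]"
    by (simp add: device_fun_def time_knife_def first_value_knife_def copy_knife_def c_def)
  then have "device_values V (cut_step n ts) t = ?ext (?ext ys (rest_knife n)) (final_trigger n ts)"
    by (simp only: device_values_def cut_step_simps step_knives_def foldl_append ys_def)
      (simp add: foldl_append)
  then have "last (device_values V (cut_step n ts) t)
      = device_fun V (final_trigger n ts) t (ys @ [cum (V n) (last ys)])"
    by (simp add: rest_knife_def device_fun_def)
  also have "\<dots> = 2 * real n * gap V n ts t"
    using ys(2,3) \<open>ys \<noteq> []\<close> by (simp add: device_fun_final_trigger[of V ts, OF assms] gap_def nth_append c_def)
  finally show ?thesis .
qed

text \<open>At the previous cut the player's own piece is worth 0, so the gap is a value of player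
  \<open>n\<close> minus 1. At 1 the chain stays at 1, so the gap is the player's value of
  everything right of the previous cut.\<close>

lemma gap_sign_change:
  assumes V: "hungry_profile n V" and n: "Suc (length ts) < n" and ts: "set ts \<subseteq> {0..1}"
  shows "gap V n ts (last (0 # ts)) \<le> 0" "0 \<le> gap V n ts 1"
proof -
  have h: "hungry (V i)" if "i \<in> {1..n}" for i
    using V that by (simp add: hungry_profile_def)
  have hs: "hungry (V j)" if "j \<in> set [length ts + 2..<n]" for j
    using h that by simp
  have T: "last (0 # ts) \<in> {0..1}"
    using last_in_set[of "0 # ts"] ts by auto
  have "hd (ts @ [1]) \<in> {0..1}"
    using ts by (cases ts) auto
  then have "0 \<le> cum (V 1) (hd (ts @ [1]))"
    using cum_range[OF h[of 1]] n by simp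
  then have "chain V (cum (V 1) (hd (ts @ [1]))) [length ts + 2..<n] 1 = 1"
    using hs by (intro chain_1) auto
  moreover have "cum (V (Suc (length ts))) (last (0 # ts)) \<le> 1"
    using cum_range[OF h T, of "Suc (length ts)"] n by simp
  ultimately show "0 \<le> gap V n ts 1"
    using n h[of n] h[of "Suc (length ts)"] by (simp add: gap_def)
  have "chain V (cum (V 1) (hd (ts @ [last (0 # ts)]))) [length ts + 2..<n] (last (0 # ts)) \<in> {0..1}"
    using hs T by (rule chain_range)
  then have "cum (V n) (chain V (cum (V 1) (hd (ts @ [last (0 # ts)]))) [length ts + 2..<n] (last (0 # ts))) \<in> {0..1}"
    using h[of n] n by (intro cum_range) auto
  then show "gap V n ts (last (0 # ts)) \<le> 0"
    unfolding gap_def by simp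
qed

lemma single_trigger_cut_step:
  assumes V: "hungry_profile n V" and n: "Suc (length ts) < n" and ts: "set ts \<subseteq> P \<inter> {0..1}"
  shows "single_trigger_step V n P (cut_step n ts) (step_knives n ts) (final_trigger n ts)"
proof
  have h: "hungry (V i)" if "i \<in> {1..n}" for i
    using V that by (simp add: hungry_profile_def)
  have T: "last (0 # ts) \<in> {0..1}"
    using last_in_set[of "0 # ts"] ts by auto
  then show "0 \<le> start (cut_step n ts)" "start (cut_step n ts) \<le> stop (cut_step n ts)" "stop (cut_step n ts) \<le> 1"
    by simp_all
  show "devices (cut_step n ts) = step_knives n ts @ [final_trigger n ts]"
    by simp
  show "step_knives n ts \<noteq> []" "hd (step_knives n ts) = time_knife"
    by (simp_all add: step_knives_def)
  show "knife d" if "d \<in> set (step_knives n ts)" for d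
    using that by (auto simp: step_knives_def device_defs)
  show "\<not> knife (final_trigger n ts)"
    by (simp add: final_trigger_def)
  show "owner d \<in> {1..n}" if "d \<in> set (devices (cut_step n ts))" for d
    using that n by (auto simp: step_knives_def device_defs)
  have "2 * real n * gap V n ts (last (0 # ts)) \<le> 0" "0 \<le> 2 * real n * gap V n ts 1"
    using gap_sign_change[OF V n] ts by (auto intro: mult_nonneg_nonpos)
  then have "2 * real n * gap V n ts (last (0 # ts)) * (2 * real n * gap V n ts 1) \<le> 0"
    by (rule mult_nonpos_nonneg)
  then show "last (device_values V (cut_step n ts) (start (cut_step n ts))) *
      last (device_values V (cut_step n ts) (stop (cut_step n ts))) \<le> 0"
    using h n by (simp add: last_device_values_cut_step)
  show "admissible V P {start (cut_step n ts)..stop (cut_step n ts)} j (devices (cut_step n ts) ! j)"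
    if j: "j < length (devices (cut_step n ts))" for j
  proof -
    \<comment> \<open>There are \<open>?q\<close> chain knives, preceded by three knives and
      followed by the rest knife and the trigger, hence \<open>?q + 5\<close> devices.\<close>
    let ?q = "n - (length ts + 2)"
    have sub: "{last (0 # ts)..1} \<subseteq> {0..1}"
      using T by auto
    have "j < ?q + 5"
      using j by (simp add: step_knives_def)
    then consider "j = 0" | "j = 1" | "j = 2" | "3 \<le> j" "j < ?q + 3" | "j = ?q + 3" | "j = ?q + 4"
      by linarith
    then show ?thesis
    proof cases
      case 1
      then show ?thesis
        using admissible_time_knife[OF sub] by (simp add: step_knives_def)
    next
      case 2
      then show ?thesis
        using admissible_first_value_knife[of V j ts P] h[of 1] n ts by (simp add: step_knives_def)
    next
      case 3
      then show ?thesis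
        using admissible_copy_knife[of j] by (simp add: step_knives_def)
    next
      case 4
      then have "devices (cut_step n ts) ! j = chain_knife (length ts + 2 + (j - 3))"
        by (simp add: step_knives_def nth_append nth_Cons' numeral_3_eq_3 less_diff_conv)
      then show ?thesis
        using admissible_chain_knife[of V _ j] h[of "length ts + 2 + (j - 3)"] 4 by simp
    next
      case 5
      then have "devices (cut_step n ts) ! j = rest_knife n"
        by (simp add: step_knives_def nth_append)
      then show ?thesis
        using admissible_rest_knife[of V n j] h[of n] 5 n by simp
    next
      case 6
      then have "devices (cut_step n ts) ! j = final_trigger n ts"
        by (simp add: step_knives_def nth_append)
      then show ?thesis
        using admissible_final_trigger[of V ts j P] h[of "Suc (length ts)"] 6 n ts by simp
    qed
  qed
qed


section \<open>The invariant carried from cut to cut\<close>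

text \<open>The error \<open>e\<close> grows by \<open>\<delta>\<close> with each cut. The last
  conjunct looks ahead: if the players still to be served, other than \<open>n\<close>, took pieces
  of value \<open>c\<close>, player \<open>n\<close> would be left with nearly \<open>c\<close>. The
  value \<open>c\<close> only exists after the first cut, hence the guard.\<close>

definition balanced :: "profile \<Rightarrow> nat \<Rightarrow> real \<Rightarrow> real list \<Rightarrow> bool" where
  "balanced V n \<delta> ts \<longleftrightarrow> set ts \<subseteq> {0..1} \<and> sorted ts \<and>
     (ts \<noteq> [] \<longrightarrow> (let c = cum (V 1) (hd ts); e = real (length ts) * \<delta> in
        (\<forall>k<length ts. \<bar>cum (V (Suc k)) (ts ! k) - cum (V (Suc k)) ((0 # ts) ! k) - c\<bar> \<le> e) \<and>
        \<bar>1 - cum (V n) (chain V c [Suc (length ts)..<n] (last ts)) - c\<bar> \<le> e))"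

text \<open>Moving from \<open>y\<close> to \<open>t\<close> pushes \<open>f\<close> and
  \<open>g\<close> in opposite directions. If \<open>f\<close> rises, then \<open>f t\<close> is at
  least \<open>- e\<close> and \<open>g t\<close> at most \<open>e\<close>; their distance of at
  most \<open>\<delta>\<close> bounds the other two sides. The other direction is symmetric.\<close>

lemma opposite_monotone_bound:
  fixes f g :: "real \<Rightarrow> real"
  assumes "mono_on S f" "antimono_on S g" "y \<in> S" "t \<in> S"
    and "\<bar>f y\<bar> \<le> e" "\<bar>g y\<bar> \<le> e" "\<bar>f t - g t\<bar> \<le> \<delta>"
  shows "\<bar>f t\<bar> \<le> e + \<delta>" "\<bar>g t\<bar> \<le> e + \<delta>"
proof -
  have "t \<le> y \<and> f t \<le> f y \<and> g y \<le> g t \<or> y \<le> t \<and> f y \<le> f t \<and> g t \<le> g y"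
    using assms(1-4) by (cases "t \<le> y") (auto simp: monotone_on_def)
  then show "\<bar>f t\<bar> \<le> e + \<delta>" "\<bar>g t\<bar> \<le> e + \<delta>"
    using assms(5-7) by linarith+
qed

lemma balanced_snoc:
  assumes V: "hungry_profile n V" and n: "Suc (length ts) < n"
    and bal: "balanced V n \<delta> ts" and t: "t \<in> {last (0 # ts)..1}" and gap: "\<bar>gap V n ts t\<bar> \<le> \<delta>"
  shows "balanced V n \<delta> (ts @ [t])"
proof -
  have h: "hungry (V i)" if "i \<in> {1..n}" for i
    using V that by (simp add: hungry_profile_def)
  have ts: "set ts \<subseteq> {0..1}" "sorted ts"
    using bal by (auto simp: balanced_def)
  have T: "last (0 # ts) \<in> {0..1}"
    using last_in_set[of "0 # ts"] ts by auto
  have t01: "t \<in> {0..1}"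
    using T t by auto
  have "x \<le> last ts" if "x \<in> set ts" for x
    using that ts(2) by (cases ts rule: rev_cases) (auto simp: sorted_append)
  then have "x \<le> t" if "x \<in> set ts" for x
    using that t by (cases "ts = []") (auto intro: order_trans)
  then have sorted: "sorted (ts @ [t])"
    using ts by (auto simp: sorted_append)
  have \<delta>: "\<delta> \<ge> 0"
    using gap by linarith
  show ?thesis
  proof (cases "ts = []")
    case True
    then show ?thesis
      \<comment> \<open>For the first cut \<open>f\<close> vanishes identically, as \<open>c\<close>
        is the value of the piece itself, so the bound on the gap is the bound on player
        \<open>n\<close>'s excess.\<close>
      using t01 gap \<delta> by (simp add: balanced_def gap_def Let_def algebra_simps numeral_2_eq_2 abs_minus_commute)
  next
    case False
    define i where "i = Suc (length ts)"
    define c where "c = cum (V 1) (hd ts)"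
    define e where "e = real (length ts) * \<delta>"
    define f where "f z = cum (V i) z - cum (V i) (last ts) - c" for z
    define g where "g z = 1 - cum (V n) (chain V c [Suc i..<n] z) - c" for z
    \<comment> \<open>The reference point: player \<open>i\<close>'s exact cut after the preceding
      one, or 1 if less than \<open>c\<close> is left.\<close>
    define y where "y = cut_point (V i) (clip (c + cum (V i) (last ts)))"
    have i: "i \<in> {1..n}" "i < n"
      using n by (simp_all add: i_def)
    have hi: "hungry (V i)" and hn: "hungry (V n)"
      using h i by simp_all
    have hs: "hungry (V j)" if "j \<in> set [Suc i..<n]" for j
      using h that by simp
    have old: "\<And>k. k < length ts \<Longrightarrow>
        \<bar>cum (V (Suc k)) (ts ! k) - cum (V (Suc k)) ((0 # ts) ! k) - c\<bar> \<le> e"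
      and rest: "\<bar>1 - cum (V n) (chain V c [i..<n] (last ts)) - c\<bar> \<le> e"
      using bal False by (auto simp: balanced_def Let_def c_def e_def i_def)
    have y: "y \<in> {0..1}"
      unfolding y_def by (intro cut_point_range hi) simp
    \<comment> \<open>The first link of the old chain leads from \<open>last ts\<close> to
      \<open>y\<close>, so \<open>g y\<close> is exactly the look-ahead term of the
      invariant.\<close>
    have gy: "\<bar>g y\<bar> \<le> e"
      using rest i(2) by (simp add: g_def y_def upt_conv_Cons)
    have "hd ts \<in> {0..1}" "last ts \<in> {0..1}"
      using False ts by (auto intro: hd_in_set last_in_set dest: subsetD)
    moreover have "hungry (V 1)"
      using h[of 1] n by simp
    ultimately have c: "c \<in> {0..1}" and T': "cum (V i) (last ts) \<in> {0..1}"
      unfolding c_def using hi by (blast intro: cum_range)+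
    \<comment> \<open>If enough is left, \<open>f y\<close> is 0. Otherwise \<open>y\<close> is 1
      and \<open>g y\<close> is \<open>- c\<close>, so \<open>c\<close> is at most \<open>e\<close>,
      while \<open>f y\<close> lies between \<open>- c\<close> and 0.\<close>
    have "\<bar>f y\<bar> \<le> e"
    proof (cases "c + cum (V i) (last ts) \<le> 1")
      case True
      then have "clip (c + cum (V i) (last ts)) = c + cum (V i) (last ts)"
        using c T' by (simp add: clip_def)
      then have "f y = 0"
        using cum_cut_point[OF hi clip_range(1), of "c + cum (V i) (last ts)"]
        by (simp add: f_def y_def)
      then show ?thesis
        using gy by linarith
    next
      case False
      then have "y = 1"
        by (simp add: y_def clip_def cut_point_1[OF hi])
      then have "g y = - c" "f y = 1 - cum (V i) (last ts) - c"
        using chain_1[of "[Suc i..<n]" V c] hs c hn hi by (simp_all add: g_def f_def)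
      then show ?thesis
        using gy False T' c by auto
    qed
    moreover have "mono_on {0..1} f"
      using cum_mono[OF hi] by (auto simp: f_def monotone_on_def)
    moreover have "antimono_on {0..1} g"
      unfolding monotone_on_def
    proof (intro ballI impI)
      fix x z :: real assume xz: "x \<in> {0..1}" "z \<in> {0..1}" "x \<le> z"
      have "chain V c [Suc i..<n] x \<le> chain V c [Suc i..<n] z"
        using hs xz by (intro chain_mono) auto
      moreover have "chain V c [Suc i..<n] x \<in> {0..1}" "chain V c [Suc i..<n] z \<in> {0..1}"
        using hs xz by (intro chain_range; simp)+
      ultimately show "g z \<le> g x"
        using cum_mono[OF hn] by (simp add: g_def)
    qed
    moreover have "\<bar>f t - g t\<bar> \<le> \<delta>"
      using gap False by (simp add: gap_def f_def g_def c_def i_def)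
    ultimately have ft: "\<bar>f t\<bar> \<le> e + \<delta>" and gt: "\<bar>g t\<bar> \<le> e + \<delta>"
      using opposite_monotone_bound[of "{0..1}" f g y t e \<delta>] y t01 gy by blast+
    have "\<bar>cum (V (Suc k)) ((ts @ [t]) ! k) - cum (V (Suc k)) ((0 # ts @ [t]) ! k) - c\<bar> \<le> e + \<delta>"
      if "k < length (ts @ [t])" for k
    proof (cases "k < length ts")
      case True
      then show ?thesis
        using old[of k] \<delta> by (cases k) (auto simp: nth_append)
    next
      case k: False
      then have "k = length ts"
        using that by simp
      then have "(0 # ts @ [t]) ! k = last ts" "(ts @ [t]) ! k = t" "Suc k = i"
        using False by (simp_all add: nth_append nth_Cons' last_conv_nth i_def)
      then show ?thesis
        using ft by (simp add: f_def)
    qed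
    moreover have "e + \<delta> = real (length (ts @ [t])) * \<delta>"
      by (simp add: e_def algebra_simps)
    ultimately show ?thesis
      using False sorted ts t01 gt
      by (simp add: balanced_def Let_def g_def c_def i_def)
  qed
qed


section \<open>The protocol\<close>

text \<open>Only the first piece is closed on the left, so that the pieces are disjoint and cover 0.
  Coinciding cuts give empty pieces to later players.\<close>

definition cut_allocation :: "nat \<Rightarrow> real list \<Rightarrow> allocation" where
  "cut_allocation n ts i =
     (let p = 0 # ts @ [1] in if i = 1 then {0..p ! 1} else {p ! (i - 1)<..p ! i})"

primrec cut_protocol :: "nat \<Rightarrow> nat \<Rightarrow> real list \<Rightarrow> protocol" where
  "cut_protocol n 0 ts = Output (cut_allocation n ts)"
| "cut_protocol n (Suc k) ts = Move (cut_step n ts) (\<lambda>(j, t, xs). cut_protocol n k (ts @ [t]))"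

section \<open>Geometry of the pieces determined by a sorted list of cuts\<close>

locale cake_partition =
  fixes n :: nat and ts :: "real list"
  assumes n: "n \<ge> 1" and length: "length ts = n - 1"
    and cake: "set ts \<subseteq> {0..1}" and sorted: "sorted ts"
begin

definition cuts :: "real list" where
  "cuts = 0 # ts @ [1]"

lemma cuts_0 [simp]: "cuts ! 0 = 0" and cuts_n [simp]: "cuts ! n = 1"
  using n length by (simp_all add: cuts_def nth_append nth_Cons')

lemma length_cuts: "length cuts = Suc n"
  using n length by (simp add: cuts_def)

lemma sorted_cuts: "sorted cuts"
  using sorted cake by (auto simp: cuts_def sorted_append)

lemma cuts_mono: "i \<le> j \<Longrightarrow> j \<le> n \<Longrightarrow> cuts ! i \<le> cuts ! j"
  using sorted_cuts length_cuts by (simp add: sorted_nth_mono)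

lemma cuts_range: "i \<le> n \<Longrightarrow> 0 \<le> cuts ! i \<and> cuts ! i \<le> 1"
  using cuts_mono[of 0 i] cuts_mono[of i n] by simp

lemma cut_allocation_1: "cut_allocation n ts 1 = {0..cuts ! 1}"
  and cut_allocation_other: "i \<noteq> 1 \<Longrightarrow> cut_allocation n ts i = {cuts ! (i - 1)<..cuts ! i}"
  by (simp_all add: cut_allocation_def cuts_def Let_def)

lemma cut_allocation_le: "x \<in> cut_allocation n ts i \<Longrightarrow> x \<le> cuts ! i"
  by (cases "i = 1") (auto simp: cut_allocation_1 cut_allocation_other simp del: One_nat_def)

lemma cut_allocation_disjoint:
  assumes "1 \<le> i" "i < j" "j \<le> n"
  shows "cut_allocation n ts i \<inter> cut_allocation n ts j = {}"
proof -
  have "cuts ! i \<le> cuts ! (j - 1)"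
    using assms by (intro cuts_mono) auto
  then show ?thesis
    using assms cut_allocation_le[of _ i] by (fastforce simp: cut_allocation_other)
qed

lemma is_interval_cut_allocation: "is_interval (cut_allocation n ts i)"
  by (cases "i = 1") (auto simp: cut_allocation_1 cut_allocation_other is_interval_cc is_interval_oc simp del: One_nat_def)

lemma connected_cut_allocation: "connected_allocation n (cut_allocation n ts)"
  unfolding connected_allocation_def is_allocation_def
proof (intro conjI ballI)
  fix i
  show "is_interval (cut_allocation n ts i)"
    by (rule is_interval_cut_allocation)
  then show "piece (cut_allocation n ts i)"
    unfolding piece_def by (intro exI[of _ "{cut_allocation n ts i}"]) (simp add: disjoint_def)
next
  show "disjoint_family_on (cut_allocation n ts) {1..n}"
    unfolding disjoint_family_on_def
  proof (intro ballI impI)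
    fix i j assume "i \<in> {1..n}" "j \<in> {1..n}" "i \<noteq> j"
    then show "cut_allocation n ts i \<inter> cut_allocation n ts j = {}"
      using cut_allocation_disjoint[of i j] cut_allocation_disjoint[of j i]
      by (cases i j rule: linorder_cases) auto
  qed
next
  show "(\<Union>i\<in>{1..n}. cut_allocation n ts i) = {0..1}"
  proof
    show "(\<Union>i\<in>{1..n}. cut_allocation n ts i) \<subseteq> {0..1}"
    proof
      fix x assume "x \<in> (\<Union>i\<in>{1..n}. cut_allocation n ts i)"
      then obtain i where i: "i \<in> {1..n}" "x \<in> cut_allocation n ts i"
        by blast
      then have "0 \<le> cuts ! (i - 1)"
        using cuts_range[of "i - 1"] by (simp add: le_diff_conv)
      then have "0 \<le> x"
        using i
        by (cases "i = 1") (auto simp: cut_allocation_1 cut_allocation_other simp del: One_nat_def)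
      moreover have "x \<le> 1"
        using cut_allocation_le[OF i(2)] cuts_range[of i] i(1) by simp
      ultimately show "x \<in> {0..1}"
        by simp
    qed
    show "{0..1} \<subseteq> (\<Union>i\<in>{1..n}. cut_allocation n ts i)"
    proof
      fix x :: real assume x: "x \<in> {0..1}"
      \<comment> \<open>The piece containing \<open>x\<close> ends at the first cut not to the left
        of \<open>x\<close>; minimality puts the cut before it strictly to the left.\<close>
      define i where "i = (LEAST i. 1 \<le> i \<and> x \<le> cuts ! i)"
      have ex: "1 \<le> n \<and> x \<le> cuts ! n"
        using x n by simp
      have i: "1 \<le> i" "x \<le> cuts ! i"
        unfolding i_def using LeastI[of "\<lambda>i. 1 \<le> i \<and> x \<le> cuts ! i", OF ex] by auto
      have "i \<le> n"
        unfolding i_def by (rule Least_le) (rule ex)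
      have "cuts ! (i - 1) < x" if "i \<noteq> 1"
        using not_less_Least[of "i - 1" "\<lambda>i. 1 \<le> i \<and> x \<le> cuts ! i"] that i(1)
        unfolding i_def[symmetric] by auto
      then have "x \<in> cut_allocation n ts i"
        using x i(2) by (cases "i = 1") (auto simp: cut_allocation_1 cut_allocation_other simp del: One_nat_def)
      then show "x \<in> (\<Union>i\<in>{1..n}. cut_allocation n ts i)"
        using i(1) \<open>i \<le> n\<close> by auto
    qed
  qed
qed

lemma worth_cut_allocation:
  assumes "hungry v" "i \<in> {1..n}"
  shows "worth v (cut_allocation n ts i) = cum v (cuts ! i) - cum v (cuts ! (i - 1))"
proof (cases "i = 1")
  case False
  have "0 \<le> cuts ! (i - 1)" "cuts ! (i - 1) \<le> cuts ! i" "cuts ! i \<le> 1"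
    using assms(2) cuts_range[of i] cuts_range[of "i - 1"] cuts_mono[of "i - 1" i]
    by (simp_all add: le_diff_conv)
  with False show ?thesis
    using worth_greaterThanAtMost[OF assms(1)] by (simp add: cut_allocation_other)
qed (simp add: cut_allocation_1 del: One_nat_def)

text \<open>The first inclusion bounds the number of cuts from above. The second, for nondegenerate
  pieces, serves to bound it from below.\<close>

lemma frontier_cut_allocation:
  assumes "i \<in> {1..n}"
  shows "frontier (cut_allocation n ts i) \<subseteq> {cuts ! (i - 1), cuts ! i}"
    and "cuts ! (i - 1) < cuts ! i \<Longrightarrow> cuts ! i \<in> frontier (cut_allocation n ts i)"
  using cuts_range[of 1] assms
  by (cases "i = 1"; cases "cuts ! (i - 1) < cuts ! i";
      force simp: cut_allocation_1 cut_allocation_other frontier_def simp del: One_nat_def)+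

lemma demarcated_cut_allocation:
  assumes "n - 1 \<le> C"
  shows "demarcated_by n C (cut_allocation n ts)"
proof -
  let ?D = "(\<Union>i\<in>{1..n}. frontier (cut_allocation n ts i)) \<inter> {0<..<1}"
  have "cuts ! i \<in> set ts \<union> {0, 1}" if "i \<le> n" for i
    using nth_mem[of i cuts] that length_cuts by (simp add: cuts_def)
  from this[of "_ - 1"] this have "{cuts ! (i - 1), cuts ! i} \<subseteq> set ts \<union> {0, 1}"
    if "i \<in> {1..n}" for i
    using that by (simp add: le_diff_conv)
  then have sub: "?D \<subseteq> set ts"
    using frontier_cut_allocation(1) by fastforce
  have "card ?D \<le> C"
    using card_mono[OF _ sub] card_length[of ts] assms length by simp
  then show ?thesis
    using finite_subset[OF sub] by (simp add: demarcated_by_def)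
qed

end

section \<open>Analysis of exact and approximate executions\<close>

text \<open>The state after \<open>m\<close> steps is determined by the \<open>m\<close> recorded
  times, which are all cut points. An error \<open>\<epsilon>\<close> in a trigger scaled by
  \<open>2 * real n\<close> is an error \<open>\<epsilon> / (2 * real n)\<close> in the gap, the
  \<open>\<delta>\<close> of the invariant.\<close>

lemma reaches_cut_protocol:
  assumes V: "hungry_profile n V" and \<epsilon>: "\<epsilon> \<ge> 0"
    and reach: "reaches V \<epsilon> (cut_protocol n (n - 1) []) m P p"
  obtains ts where "length ts = m" "m \<le> n - 1" "p = cut_protocol n (n - 1 - m) ts"
    "set ts \<subseteq> P \<inter> {0..1}" "balanced V n (\<epsilon> / (2 * real n)) ts"
proof -
  from reach have "\<exists>ts. length ts = m \<and> m \<le> n - 1 \<and> p = cut_protocol n (n - 1 - m) ts \<and>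
    set ts \<subseteq> P \<inter> {0..1} \<and> balanced V n (\<epsilon> / (2 * real n)) ts"
  proof induction
    case init
    show ?case
      by (intro exI[of _ "[]"]) (simp add: balanced_def)
  next
    case (query m P i q k a)
    then obtain ts where "Query i q k = cut_protocol n (n - 1 - m) ts"
      by blast
    then show ?case
      \<comment> \<open>The protocol never asks a query outside a moving knife step, so this case is
        contradictory.\<close>
      by (cases "n - 1 - m") auto
  next
    case (move m P s k j t xs)
    then obtain ts where ts: "length ts = m" "m \<le> n - 1" "Move s k = cut_protocol n (n - 1 - m) ts"
      "set ts \<subseteq> P \<inter> {0..1}" "balanced V n (\<epsilon> / (2 * real n)) ts"
      by blast
    from ts(3) have m: "n - 1 - m = Suc (n - 1 - Suc m)"
      by (cases "n - 1 - m") auto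
    then have n: "Suc (length ts) < n"
      using ts(1) by simp
    have s: "s = cut_step n ts" and k: "k (j, t, xs) = cut_protocol n (n - 1 - Suc m) (ts @ [t])"
      using ts(3) unfolding m by simp_all
    interpret single_trigger_step V n P "cut_step n ts" "step_knives n ts" "final_trigger n ts"
      using single_trigger_cut_step[OF V n ts(4)] .
    have "hungry (V (Suc (length ts)))"
      using V n by (simp add: hungry_profile_def)
    then have t: "t \<in> {last (0 # ts)..1}" and "\<bar>2 * real n * gap V n ts t\<bar> \<le> \<epsilon>"
      using eps_outcomeD[of \<epsilon> j t xs] move.hyps(2) by (simp_all add: s last_device_values_cut_step)
    then have "\<bar>gap V n ts t\<bar> \<le> \<epsilon> / (2 * real n)"
      using n by (simp add: abs_mult field_simps)
    then have bal: "balanced V n (\<epsilon> / (2 * real n)) (ts @ [t])"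
      by (rule balanced_snoc[OF V n ts(5) t])
    then have "set (ts @ [t]) \<subseteq> {0..1}"
      by (simp add: balanced_def)
    then show ?case
      using bal ts m k by (intro exI[of _ "ts @ [t]"]) auto
  qed
  then show ?thesis
    using that by blast
qed

lemma balanced_imp_cake_partition:
  assumes "n \<ge> 1" "length ts = n - 1" "balanced V n \<delta> ts"
  shows "cake_partition n ts"
  using assms by (auto simp: balanced_def cake_partition_def)

text \<open>After the last cut the chain is empty, so the look-ahead term concerns player
  \<open>n\<close>'s actual piece. Every piece is within \<open>e\<close> of \<open>c\<close>, and
  comparing two pieces through \<open>c\<close> costs \<open>2 * e\<close>, which the scaling by
  \<open>2 * real n\<close> keeps within \<open>\<epsilon>\<close>.\<close>

lemma balanced_eps_equitable:
  assumes V: "hungry_profile n V" and n: "n \<ge> 1" and \<epsilon>: "\<epsilon> \<ge> 0"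
    and len: "length ts = n - 1" and bal: "balanced V n (\<epsilon> / (2 * real n)) ts"
  shows "eps_equitable n \<epsilon> V (cut_allocation n ts)"
proof -
  interpret cake_partition n ts
    using n len bal by (rule balanced_imp_cake_partition)
  have h: "hungry (V i)" if "i \<in> {1..n}" for i
    using V that by (simp add: hungry_profile_def)
  show ?thesis
  proof (cases "ts = []")
    case True
    then show ?thesis
      using \<epsilon> n len by (auto simp: eps_equitable_def)
  next
    case False
    define c where "c = cum (V 1) (hd ts)"
    define e where "e = real (n - 1) * (\<epsilon> / (2 * real n))"
    have old: "\<And>k. k < n - 1 \<Longrightarrow>
        \<bar>cum (V (Suc k)) (ts ! k) - cum (V (Suc k)) ((0 # ts) ! k) - c\<bar> \<le> e"
      and rest: "\<bar>1 - cum (V n) (last ts) - c\<bar> \<le> e"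
      using bal False len n by (simp_all add: balanced_def Let_def c_def e_def)
    have near: "\<bar>worth (V i) (cut_allocation n ts i) - c\<bar> \<le> e" if i: "i \<in> {1..n}" for i
    proof (cases "i = n")
      case True
      have "cuts ! (n - 1) = last ts"
        using False unfolding len[symmetric] cuts_def
        by (cases ts rule: rev_cases) (simp_all add: nth_append)
      then show ?thesis
        using rest True n h[of n] worth_cut_allocation[OF h[OF i] i] by simp
    next
      case False
      then obtain k where k: "i = Suc k" "k < n - 1"
        using i by (cases i) auto
      then have "cuts ! i = ts ! k" "cuts ! (i - 1) = (0 # ts) ! k"
        using len by (simp_all add: cuts_def nth_Cons' nth_append)
      then show ?thesis
        using old[OF k(2)] k(1) worth_cut_allocation[OF h[OF i] i] by simp
    qed
    have "2 * e \<le> \<epsilon>"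
      using \<epsilon> n by (simp add: e_def field_simps of_nat_diff)
    then show ?thesis
      unfolding eps_equitable_def using near by (smt (verit))
  qed
qed

lemma eps_equitable_0_imp_equitable:
  assumes "eps_equitable n 0 V (cut_allocation n ts)" "cake_partition n ts" "hungry_profile n V"
  shows "equitable n V (cut_allocation n ts)"
proof -
  interpret cake_partition n ts
    by fact
  have h: "hungry (V 1)" and 1: "1 \<in> {1..n}"
    using assms(3) n by (simp_all add: hungry_profile_def)
  have "worth (V 1) (cut_allocation n ts 1) \<in> {0..1}"
    using cum_range[OF h, of "cuts ! 1"] cuts_range[of 1] n
    by (simp add: cut_allocation_1 del: One_nat_def)
  moreover have "worth (V i) (cut_allocation n ts i) = worth (V 1) (cut_allocation n ts 1)"
    if "i \<in> {1..n}" for i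
    using assms(1) that 1 unfolding eps_equitable_def by fastforce
  ultimately show ?thesis
    unfolding equitable_def by blast
qed

text \<open>Exact executions are the case \<open>\<epsilon> = 0\<close>, so fairness and robustness
  share this analysis.\<close>

lemma outputs_cut_protocol:
  assumes V: "hungry_profile n V" and n: "n \<ge> 1" and \<epsilon>: "\<epsilon> \<ge> 0"
    and out: "outputs V \<epsilon> (cut_protocol n (n - 1) []) A"
  obtains ts where "A = cut_allocation n ts" "cake_partition n ts" "eps_equitable n \<epsilon> V A"
proof -
  obtain m P where "reaches V \<epsilon> (cut_protocol n (n - 1) []) m P (Output A)"
    using out by (auto simp: outputs_def)
  then obtain ts where ts: "length ts = m" "m \<le> n - 1" "Output A = cut_protocol n (n - 1 - m) ts"
    "balanced V n (\<epsilon> / (2 * real n)) ts"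
    using reaches_cut_protocol[OF V \<epsilon>] by metis
  then have m: "n - 1 - m = 0"
    by (cases "n - 1 - m") auto
  then have A: "A = cut_allocation n ts" and len: "length ts = n - 1"
    using ts by auto
  show ?thesis
    using that[OF A] balanced_imp_cake_partition[OF n len ts(4)]
      balanced_eps_equitable[OF V n \<epsilon> len ts(4)] A by blast
qed

lemma legal_execution_cut_protocol:
  assumes V: "hungry_profile n V" and n: "n \<ge> 1" and \<epsilon>: "\<epsilon> \<ge> 0" and r: "n - 1 \<le> r"
  shows "legal_execution n V (n + 4) 2 \<epsilon> r (cut_protocol n (n - 1) [])"
  unfolding legal_execution_def
proof (intro allI impI)
  fix m P p'
  assume "reaches V \<epsilon> (cut_protocol n (n - 1) []) m P p'"
  then obtain ts where ts: "length ts = m" "m \<le> n - 1" "p' = cut_protocol n (n - 1 - m) ts"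
    "set ts \<subseteq> P \<inter> {0..1}" "balanced V n (\<epsilon> / (2 * real n)) ts"
    using reaches_cut_protocol[OF V \<epsilon>] by metis
  have "case p' of Output A \<Rightarrow> is_allocation n A
      | Query i q k \<Rightarrow> i \<in> {1..n} \<and> legal_query P q
      | Move s k \<Rightarrow> legal_step n V (n + 4) 2 P s"
  proof (cases "n - 1 - m")
    case 0
    then have "length ts = n - 1"
      using ts by simp
    then interpret cake_partition n ts
      using balanced_imp_cake_partition[OF n _ ts(5)] by blast
    show ?thesis
      using connected_cut_allocation 0 ts(3) by (simp add: connected_allocation_def)
  next
    case (Suc k)
    then have "Suc (length ts) < n"
      using ts(1) by simp
    then interpret single_trigger_step V n P "cut_step n ts" "step_knives n ts" "final_trigger n ts"
      using single_trigger_cut_step[OF V _ ts(4)] by blast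
    have "legal_step n V (n + 4) 2 P (cut_step n ts)"
      \<comment> \<open>The step has \<open>n - length ts + 3\<close> devices.\<close>
      by (rule legal_step) (use Suc in \<open>simp add: step_knives_def\<close>)
    then show ?thesis
      using Suc ts(3) by simp
  qed
  then show "m \<le> r \<and> (case p' of Output A \<Rightarrow> is_allocation n A
      | Query i q k \<Rightarrow> i \<in> {1..n} \<and> legal_query P q
      | Move s k \<Rightarrow> legal_step n V (n + 4) 2 P s)"
    using ts(2) r by simp
qed

section \<open>Lower bounds on the numbers of steps and cuts\<close>

text \<open>A bound on the lengths of all executions says something about \<open>r\<close> only if
  long executions exist, so they are built from exact outcomes.\<close>

lemma exact_execution_exists:
  assumes V: "hungry_profile n V" and "m \<le> n - 1"
  shows "\<exists>P p'. reaches V 0 (cut_protocol n (n - 1) []) m P p'"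
  using assms(2)
proof (induction m)
  case 0
  show ?case
    using reaches.init by blast
next
  case (Suc m)
  then obtain P p' where reach: "reaches V 0 (cut_protocol n (n - 1) []) m P p'"
    by auto
  then obtain ts where ts: "length ts = m" "p' = cut_protocol n (n - 1 - m) ts" "set ts \<subseteq> P \<inter> {0..1}"
    using reaches_cut_protocol[OF V order_refl] by metis
  have n: "Suc (length ts) < n" and m: "n - 1 - m = Suc (n - 1 - Suc m)"
    using Suc.prems ts(1) by simp_all
  interpret single_trigger_step V n P "cut_step n ts" "step_knives n ts" "final_trigger n ts"
    using single_trigger_cut_step[OF V n ts(3)] .
  obtain j t xs where "eps_outcome V 0 (cut_step n ts) (j, t, xs)"
    using exact_outcome_exists by auto
  then show ?case
    using reaches.move[OF reach[unfolded ts(2) m cut_protocol.simps]] by blast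
qed

lemma exact_output_exists:
  assumes V: "hungry_profile n V"
  obtains P A where "reaches V 0 (cut_protocol n (n - 1) []) (n - 1) P (Output A)"
proof -
  obtain P p' where reach: "reaches V 0 (cut_protocol n (n - 1) []) (n - 1) P p'"
    using exact_execution_exists[OF V order_refl] by blast
  then obtain ts where "p' = cut_protocol n (n - 1 - (n - 1)) ts"
    using reaches_cut_protocol[OF V order_refl] by metis
  then show ?thesis
    using that reach by simp
qed

lemma cum_uniform: "y \<ge> 0 \<Longrightarrow> cum (\<lambda>_. 1) y = y"
  by (simp add: worth_def)

lemma hungry_uniform: "hungry (\<lambda>_. 1)"
  by (simp add: hungry_def value_density_def integrable_const_ivl)

text \<open>For uniform valuations equitable pieces have equal length, so the cuts lie at the
  multiples of \<open>c\<close>, where \<open>n\<close> times \<open>c\<close> is 1. The first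
  \<open>n - 1\<close> multiples are distinct interior frontier points.\<close>

lemma uniform_cuts_necessary:
  assumes "cake_partition n ts" and eq: "equitable n (\<lambda>_ _. 1) (cut_allocation n ts)"
    and dem: "demarcated_by n C (cut_allocation n ts)"
  shows "n - 1 \<le> C"
proof -
  interpret cake_partition n ts
    by fact
  obtain c where c: "\<And>i. i \<in> {1..n} \<Longrightarrow> worth (\<lambda>_. 1) (cut_allocation n ts i) = c"
    using eq by (auto simp: equitable_def)
  have step: "cuts ! i = cuts ! (i - 1) + c" if "i \<in> {1..n}" for i
    using c[OF that] worth_cut_allocation[OF hungry_uniform that] cuts_range[of i] cuts_range[of "i - 1"] that
    by (simp add: cum_uniform le_diff_conv)
  have lin: "cuts ! i = real i * c" if "i \<le> n" for i
    using that
  proof (induction i)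
    case (Suc i)
    then show ?case
      using step[of "Suc i"] by (simp add: algebra_simps)
  qed simp
  have nc: "real n * c = 1"
    using lin[of n] by simp
  then have "c > 0"
    using n by (metis of_nat_0_le_iff mult_nonneg_nonpos not_less not_one_le_zero)
  let ?D = "(\<Union>i\<in>{1..n}. frontier (cut_allocation n ts i)) \<inter> {0<..<1}"
  have "(\<lambda>i. real i * c) ` {1..n - 1} \<subseteq> ?D"
  proof
    fix x assume "x \<in> (\<lambda>i. real i * c) ` {1..n - 1}"
    then obtain i where i: "i \<in> {1..n - 1}" "x = real i * c"
      by blast
    then have "x = cuts ! i" "i \<in> {1..n}"
      using lin[of i] by auto
    moreover have "x < real n * c"
      using i \<open>c > 0\<close> by (auto intro!: mult_strict_right_mono)
    moreover have "0 < x"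
      using i \<open>c > 0\<close> by simp
    ultimately show "x \<in> ?D"
      using frontier_cut_allocation(2)[of i] step[of i] \<open>c > 0\<close> nc by auto
  qed
  moreover have "finite ?D" "card ?D \<le> C"
    using dem by (simp_all add: demarcated_by_def Let_def)
  ultimately have "card ((\<lambda>i. real i * c) ` {1..n - 1}) \<le> C"
    using card_mono order_trans by blast
  moreover have "inj_on (\<lambda>i. real i * c) {1..n - 1}"
    using \<open>c > 0\<close> by (auto simp: inj_on_def)
  ultimately show ?thesis
    by (simp add: card_image)
qed

text \<open>The bounds \<open>r\<close> and \<open>C\<close> are arbitrary, subject to holding for
  exact executions on all hungry profiles. The uniform profile forces both to be at least
  \<open>n - 1\<close>, and approximate executions stay within \<open>n - 1\<close> steps and
  cuts.\<close>

lemma robust_cut_protocol: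
  assumes n: "n \<ge> 1"
  shows "robust_equitable n (n + 4) 2 (cut_protocol n (n - 1) [])"
  unfolding robust_equitable_def
proof (intro allI impI)
  fix r C and \<epsilon> :: real and V
  assume exact: "\<forall>V. hungry_profile n V \<longrightarrow>
      legal_execution n V (n + 4) 2 0 r (cut_protocol n (n - 1) []) \<and>
      (\<forall>A. outputs V 0 (cut_protocol n (n - 1) []) A \<longrightarrow> equitable n V A \<and> demarcated_by n C A)"
    and \<epsilon>: "0 < \<epsilon>" and V: "hungry_profile n V"
  have U: "hungry_profile n (\<lambda>_ _. 1)"
    using hungry_uniform by (simp add: hungry_profile_def)
  obtain P A where reach: "reaches (\<lambda>_ _. 1) 0 (cut_protocol n (n - 1) []) (n - 1) P (Output A)"
    using exact_output_exists[OF U] .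
  then have r: "n - 1 \<le> r"
    using exact U unfolding legal_execution_def by blast
  have out: "outputs (\<lambda>_ _. 1) 0 (cut_protocol n (n - 1) []) A"
    using reach by (auto simp: outputs_def)
  then obtain us where "A = cut_allocation n us" "cake_partition n us"
    using outputs_cut_protocol[OF U n order_refl] by metis
  then have C: "n - 1 \<le> C"
    using uniform_cuts_necessary exact U out by blast
  show "legal_execution n V (n + 4) 2 \<epsilon> r (cut_protocol n (n - 1) []) \<and>
      (\<forall>A. outputs V \<epsilon> (cut_protocol n (n - 1) []) A \<longrightarrow> eps_equitable n \<epsilon> V A \<and> demarcated_by n C A)"
  proof (intro conjI allI impI)
    show "legal_execution n V (n + 4) 2 \<epsilon> r (cut_protocol n (n - 1) [])"
      using legal_execution_cut_protocol[OF V n _ r] \<epsilon> by simp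
    fix A assume "outputs V \<epsilon> (cut_protocol n (n - 1) []) A"
    then obtain ts where "A = cut_allocation n ts" "cake_partition n ts" "eps_equitable n \<epsilon> V A"
      using outputs_cut_protocol[OF V n less_imp_le[OF \<epsilon>]] by metis
    then show "eps_equitable n \<epsilon> V A" "demarcated_by n C A"
      using cake_partition.demarcated_cut_allocation C by blast+
  qed
qed

theorem theorem7p3:
  fixes n :: nat
  assumes "n \<ge> 1"
  shows "\<exists>p. RW_moving_knife_protocol n p \<and> computes_connected_equitable n p"
proof (intro exI conjI)
  show "RW_moving_knife_protocol n (cut_protocol n (n - 1) [])"
    unfolding RW_moving_knife_protocol_def
    using legal_execution_cut_protocol[OF _ assms order_refl order_refl] robust_cut_protocol[OF assms]
    by blast
  show "computes_connected_equitable n (cut_protocol n (n - 1) [])"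
    unfolding computes_connected_equitable_def
  proof (intro allI impI)
    fix V A
    assume V: "hungry_profile n V" and "outputs V 0 (cut_protocol n (n - 1) []) A"
    then obtain ts where "A = cut_allocation n ts" "cake_partition n ts" "eps_equitable n 0 V A"
      using outputs_cut_protocol[OF V assms order_refl] by metis
    then show "connected_allocation n A \<and> equitable n V A"
      using cake_partition.connected_cut_allocation eps_equitable_0_imp_equitable V by blast
  qed
qed

end
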